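(* Let $d\in\{2,3\}$ and $D=(0,1)^d$. If $\alpha>1+d/2$ and $v$ is a random function drawn from the Gaussian measure $\mu_{0,\alpha}=\mathcal N(0,\mathcal C^{\alpha/2})$, then almost surely the function $u=S(v)$ has finite total variation norm on $D$.
   Context: $D=(0,1)^d$, $d=2,3$, is the unit cube and $H=L^2(D)$. $H^k_\#(D)$ denotes the space of periodic functions in the Sobolev space $H^k(D)$ (periodic with respect to the unit cube; equivalently weighted $\ell^2$ spaces of Fourier coefficients). Covariance operator: fix constants $\varepsilon\in(0,1)$, $\delta>0$, $\tau>0$, $q\ge 0$, and $a_1,a_2,a_3\ge 0$. The operator $\mathcal C:H\to H$ is the solution operator $f\mapsto\eta$ of the (weakly formulated) elliptic problem with periodic boundary conditions: given $f\in H$ find $\eta\in H^2_\#(D)$ with $$\delta\varepsilon^{-2a_1}\Delta^2\eta-q\delta\varepsilon^{-2a_2}\Delta\eta+\tau^2\delta\varepsilon^{-2a_3}\eta=f .$$ $\mathcal C^{\alpha/2}$ is the fractional power of this positive self-adjoint operator, and $\mathcal N(0,\mathcal C^{\alpha/2})$ is the centred Gaussian measure with that covariance operator (for $\alpha>d/2$ its samples are almost surely continuous). The thresholding function $S:\mathbb R\to\{-1,0,1\}$ is $S(t)=1$ for $t>0$, $S(0)=0$, $S(t)=-1$ for $t<0$; $S(v)$ denotes pointwise application. The total variation of $u$ is $\int_D|\nabla u|$. *)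

theory Defs
  imports "HOL-Probability.Probability"
begin

section \<open>The space $L^2(D)$ on the open unit cube\<close>

definition unit_cube :: "(real ^ 'd::finite) set" where
  "unit_cube = {x. \<forall>i. 0 < x $ i \<and> x $ i < 1}"

abbreviation cube_measure :: "(real ^ 'd::finite) measure" where
  "cube_measure \<equiv> lebesgue_on unit_cube"

definition square_integrable :: "(real ^ 'd::finite \<Rightarrow> real) \<Rightarrow> bool" where
  "square_integrable f \<longleftrightarrow>
     f \<in> borel_measurable cube_measure \<and> integrable cube_measure (\<lambda>x. (f x)\<^sup>2)"

lemma square_integrable_mult:
  assumes "square_integrable f" "square_integrable g"
  shows "integrable cube_measure (\<lambda>x. f x * g x)"
proof (rule Bochner_Integration.integrable_bound)
  show "integrable cube_measure (\<lambda>x. (f x)\<^sup>2 + (g x)\<^sup>2)"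
    using assms by (auto simp: square_integrable_def)
  show "(\<lambda>x. f x * g x) \<in> borel_measurable cube_measure"
    using assms by (auto simp: square_integrable_def)
  have "norm (a * b) \<le> norm (a\<^sup>2 + b\<^sup>2)" for a b :: real
  proof -
    have "2 * (\<bar>a\<bar> * \<bar>b\<bar>) \<le> a\<^sup>2 + b\<^sup>2"
      using sum_squares_bound[of "\<bar>a\<bar>" "\<bar>b\<bar>"] by (simp add: mult.assoc)
    moreover have "0 \<le> \<bar>a\<bar> * \<bar>b\<bar>" by simp
    ultimately have "\<bar>a\<bar> * \<bar>b\<bar> \<le> a\<^sup>2 + b\<^sup>2" by linarith
    then show ?thesis by (simp add: abs_mult)
  qed
  then show "AE x in cube_measure. norm (f x * g x) \<le> norm ((f x)\<^sup>2 + (g x)\<^sup>2)"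
    by simp
qed

lemma square_integrable_zero: "square_integrable (\<lambda>x. 0)"
  by (simp add: square_integrable_def)

lemma square_integrable_scale:
  "square_integrable f \<Longrightarrow> square_integrable (\<lambda>x. c * f x)"
  by (auto simp: square_integrable_def power_mult_distrib)

lemma square_integrable_add:
  assumes "square_integrable f" "square_integrable g"
  shows "square_integrable (\<lambda>x. f x + g x)"
proof -
  have "integrable cube_measure (\<lambda>x. ((f x)\<^sup>2 + (g x)\<^sup>2) + 2 * (f x * g x))"
    using assms square_integrable_mult[OF assms]
    by (intro Bochner_Integration.integrable_add integrable_mult_right)
       (auto simp: square_integrable_def)
  then show ?thesis
    using assms by (auto simp: square_integrable_def power2_sum algebra_simps)
qed

lemma square_integrable_uminus:
  "square_integrable f \<Longrightarrow> square_integrable (\<lambda>x. - f x)"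
  by (auto simp: square_integrable_def)

lemma square_integrable_diff:
  "square_integrable f \<Longrightarrow> square_integrable g \<Longrightarrow> square_integrable (\<lambda>x. f x - g x)"
  using square_integrable_add[OF _ square_integrable_uminus, of f g] by simp

quotient_type (overloaded) 'd l2 =
  "real ^ 'd::finite \<Rightarrow> real" / partial:
  "\<lambda>f g. square_integrable f \<and> square_integrable g \<and> (AE x in cube_measure. f x = g x)"
proof (rule part_equivpI)
  show "\<exists>f::real ^ 'd \<Rightarrow> real. square_integrable f \<and> square_integrable f \<and>
      (AE x in cube_measure. f x = f x)"
    using square_integrable_zero by auto
  show "symp (\<lambda>f g::real ^ 'd \<Rightarrow> real. square_integrable f \<and> square_integrable g \<and>
      (AE x in cube_measure. f x = g x))"
    by (auto simp: symp_def elim: eventually_mono)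
  show "transp (\<lambda>f g::real ^ 'd \<Rightarrow> real. square_integrable f \<and> square_integrable g \<and>
      (AE x in cube_measure. f x = g x))"
    by (auto simp: transp_def elim: eventually_elim2)
qed

instantiation l2 :: (finite) real_inner
begin

lift_definition zero_l2 :: "'a l2" is "\<lambda>x. 0"
  by (simp add: square_integrable_zero)

lift_definition plus_l2 :: "'a l2 \<Rightarrow> 'a l2 \<Rightarrow> 'a l2" is "\<lambda>f g x. f x + g x"
  by (auto simp: square_integrable_add elim: eventually_elim2)

lift_definition uminus_l2 :: "'a l2 \<Rightarrow> 'a l2" is "\<lambda>f x. - f x"
  by (auto simp: square_integrable_uminus)

lift_definition minus_l2 :: "'a l2 \<Rightarrow> 'a l2 \<Rightarrow> 'a l2" is "\<lambda>f g x. f x - g x"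
  by (auto simp: square_integrable_diff elim: eventually_elim2)

lift_definition scaleR_l2 :: "real \<Rightarrow> 'a l2 \<Rightarrow> 'a l2" is "\<lambda>c f x. c * f x"
  by (auto simp: square_integrable_scale elim: eventually_mono)

lift_definition inner_l2 :: "'a l2 \<Rightarrow> 'a l2 \<Rightarrow> real"
  is "\<lambda>f g. integral\<^sup>L cube_measure (\<lambda>x. f x * g x)"
proof -
  fix f f' g g' :: "real ^ 'a \<Rightarrow> real"
  assume f: "square_integrable f \<and> square_integrable f' \<and> (AE x in cube_measure. f x = f' x)"
    and g: "square_integrable g \<and> square_integrable g' \<and> (AE x in cube_measure. g x = g' x)"
  from f g have "AE x in cube_measure. f x = f' x" "AE x in cube_measure. g x = g' x"
    by blast+
  then have "AE x in cube_measure. f x * g x = f' x * g' x"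
    by eventually_elim simp
  with f g show "integral\<^sup>L cube_measure (\<lambda>x. f x * g x) =
      integral\<^sup>L cube_measure (\<lambda>x. f' x * g' x)"
    by (intro integral_cong_AE) (auto simp: square_integrable_def)
qed

definition norm_l2 :: "'a l2 \<Rightarrow> real" where
  "norm_l2 f = sqrt (inner f f)"

definition sgn_l2 :: "'a l2 \<Rightarrow> 'a l2" where
  "sgn_l2 f = inverse (norm f) *\<^sub>R f"

definition dist_l2 :: "'a l2 \<Rightarrow> 'a l2 \<Rightarrow> real" where
  "dist_l2 f g = norm (f - g)"

definition uniformity_l2 :: "('a l2 \<times> 'a l2) filter" where
  "uniformity_l2 = (INF e\<in>{0 <..}. principal {(x, y). dist x y < e})"

definition open_l2 :: "'a l2 set \<Rightarrow> bool" where
  "open_l2 U = (\<forall>x\<in>U. eventually (\<lambda>(x', y). x' = x \<longrightarrow> y \<in> U) uniformity)"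

instance
proof
  fix f g h :: "'a l2" and a b :: real
  show "f + g + h = f + (g + h)"
    by transfer (auto simp: square_integrable_add add.assoc)
  show "f + g = g + f"
    by transfer (auto simp: square_integrable_add add.commute)
  show "0 + f = f" by transfer simp
  show "- f + f = 0" by transfer (auto simp: square_integrable_zero)
  show "f - g = f + - g"
    by transfer (auto simp: square_integrable_diff)
  show "a *\<^sub>R (f + g) = a *\<^sub>R f + a *\<^sub>R g"
    by transfer (simp add: square_integrable_add square_integrable_scale distrib_left
        flip: distrib_left)
  show "(a + b) *\<^sub>R f = a *\<^sub>R f + b *\<^sub>R f"
    by transfer (simp add: square_integrable_scale square_integrable_add distrib_right
        flip: distrib_right)
  show "a *\<^sub>R b *\<^sub>R f = (a * b) *\<^sub>R f"
    by transfer (simp add: square_integrable_scale mult.assoc)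
  show "1 *\<^sub>R f = f" by transfer simp
  show "dist f g = norm (f - g)" by (simp add: dist_l2_def)
  show "sgn f = inverse (norm f) *\<^sub>R f" by (simp add: sgn_l2_def)
  show "(uniformity :: ('a l2 \<times> 'a l2) filter) =
      (INF e\<in>{0 <..}. principal {(x, y). dist x y < e})"
    by (simp add: uniformity_l2_def)
  show "open U = (\<forall>x\<in>U. eventually (\<lambda>(x', y). x' = x \<longrightarrow> y \<in> U) uniformity)"
    for U :: "'a l2 set"
    by (simp add: open_l2_def)
  show "inner f g = inner g f" by transfer (simp add: mult.commute)
  show "inner (f + g) h = inner f h + inner g h"
    by transfer (simp add: distrib_right square_integrable_mult)
  show "inner (a *\<^sub>R f) g = a * inner f g"
    by transfer (simp add: mult.assoc)
  show "0 \<le> inner f f" by transfer simp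
  show "inner f f = 0 \<longleftrightarrow> f = 0"
    by transfer (auto simp: integral_nonneg_eq_0_iff_AE square_integrable_mult
        square_integrable_zero)
  show "norm f = sqrt (inner f f)" by (simp add: norm_l2_def)
qed

end

definition l2_class :: "(real ^ 'd::finite \<Rightarrow> real) \<Rightarrow> 'd l2" where
  "l2_class = abs_l2"

definition represents :: "(real ^ 'd::finite \<Rightarrow> real) \<Rightarrow> 'd l2 \<Rightarrow> bool" where
  "represents w f \<longleftrightarrow> square_integrable w \<and> l2_class w = f"


section \<open>Differentiability and periodic Sobolev spaces\<close>

definition C1 :: "('a::euclidean_space \<Rightarrow> 'b::euclidean_space) \<Rightarrow> bool" where
  "C1 f \<longleftrightarrow> (\<forall>x. f differentiable (at x)) \<and>
     (\<forall>h. continuous_on UNIV (\<lambda>x. frechet_derivative f (at x) h))"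

definition partial_deriv ::
    "'d::finite \<Rightarrow> (real ^ 'd \<Rightarrow> 'b::euclidean_space) \<Rightarrow> real ^ 'd \<Rightarrow> 'b" where
  "partial_deriv i f x = frechet_derivative f (at x) (axis i 1)"

definition divergence :: "(real ^ 'd::finite \<Rightarrow> real ^ 'd) \<Rightarrow> real ^ 'd \<Rightarrow> real" where
  "divergence \<phi> x = (\<Sum>i\<in>UNIV. partial_deriv i \<phi> x $ i)"

definition periodic :: "(real ^ 'd::finite \<Rightarrow> 'b) \<Rightarrow> bool" where
  "periodic f \<longleftrightarrow> (\<forall>x i. f (x + axis i 1) = f x)"

text \<open>The test functions are periodic on the whole space rather than compactly supported in
  the cube, so a weak derivative in this sense sees no jump of the periodic extension across the
  boundary of the cube. This is what makes the spaces below the periodic Sobolev spaces.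
  By density, testing with $C^1$ or with smooth periodic functions makes no difference.\<close>

definition has_weak_partial :: "'d::finite \<Rightarrow> 'd l2 \<Rightarrow> 'd l2 \<Rightarrow> bool" where
  "has_weak_partial i f g \<longleftrightarrow>
     (\<forall>\<psi>. C1 \<psi> \<longrightarrow> periodic \<psi> \<longrightarrow>
        inner f (l2_class (partial_deriv i \<psi>)) = - inner g (l2_class \<psi>))"

primrec periodic_sobolev :: "nat \<Rightarrow> ('d::finite l2) set" where
  "periodic_sobolev 0 = UNIV"
| "periodic_sobolev (Suc k) =
     {f. \<forall>i. \<exists>g \<in> periodic_sobolev k. has_weak_partial i f g}"

text \<open>Weak derivatives are unique, so the description operator below is well defined on
  \<open>periodic_sobolev 1\<close>.\<close>

definition weak_partial :: "'d::finite \<Rightarrow> 'd l2 \<Rightarrow> 'd l2" where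
  "weak_partial i f = (THE g. has_weak_partial i f g)"

definition weak_laplacian :: "'d::finite l2 \<Rightarrow> 'd l2" where
  "weak_laplacian f = (\<Sum>i\<in>UNIV. weak_partial i (weak_partial i f))"


section \<open>The covariance operator and its fractional powers\<close>

definition weak_solution ::
    "real \<Rightarrow> real \<Rightarrow> real \<Rightarrow> real \<Rightarrow> real \<Rightarrow> real \<Rightarrow> real \<Rightarrow> 'd::finite l2 \<Rightarrow> 'd l2 \<Rightarrow> bool" where
  "weak_solution \<delta> \<epsilon> q \<tau> a1 a2 a3 f \<eta> \<longleftrightarrow>
     \<eta> \<in> periodic_sobolev 2 \<and>
     (\<forall>\<phi> \<in> periodic_sobolev 2.
        \<delta> * \<epsilon> powr (- 2 * a1) * inner (weak_laplacian \<eta>) (weak_laplacian \<phi>)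
        + q * \<delta> * \<epsilon> powr (- 2 * a2) *
            (\<Sum>i\<in>UNIV. inner (weak_partial i \<eta>) (weak_partial i \<phi>))
        + \<tau>\<^sup>2 * \<delta> * \<epsilon> powr (- 2 * a3) * inner \<eta> \<phi>
        = inner f \<phi>)"

text \<open>For \<open>0 < \<delta>\<close>, \<open>0 < \<tau>\<close>, \<open>0 < \<epsilon>\<close> and \<open>0 \<le> q\<close> the bilinear form above is coercive on
  \<open>periodic_sobolev 2\<close>, so by Lax-Milgram exactly one operator satisfies the next definition.\<close>

definition solution_operator ::
    "real \<Rightarrow> real \<Rightarrow> real \<Rightarrow> real \<Rightarrow> real \<Rightarrow> real \<Rightarrow> real \<Rightarrow> ('d::finite l2 \<Rightarrow> 'd l2) \<Rightarrow> bool" where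
  "solution_operator \<delta> \<epsilon> q \<tau> a1 a2 a3 C \<longleftrightarrow>
     (\<forall>f. weak_solution \<delta> \<epsilon> q \<tau> a1 a2 a3 f (C f))"

text \<open>\<open>R\<close> is the fractional power $T^s$ of an operator \<open>T\<close> that is diagonal in an orthonormal
  basis with positive eigenvalues (every injective positive compact self-adjoint operator on an
  infinite-dimensional separable Hilbert space is). By the spectral theorem \<open>R\<close> does not depend
  on the choice of the eigenbasis.\<close>

definition fractional_power ::
    "('a::real_inner \<Rightarrow> 'a) \<Rightarrow> real \<Rightarrow> ('a \<Rightarrow> 'a) \<Rightarrow> bool" where
  "fractional_power T s R \<longleftrightarrow>
     (\<exists>(e :: nat \<Rightarrow> 'a) \<kappa>.
        (\<forall>m n. inner (e m) (e n) = (if m = n then 1 else 0)) \<and>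
        (\<forall>f. (\<lambda>n. inner f (e n) *\<^sub>R e n) sums f) \<and>
        (\<forall>n. 0 < \<kappa> n \<and> T (e n) = \<kappa> n *\<^sub>R e n) \<and>
        (\<forall>f. (\<lambda>n. (\<kappa> n powr s * inner f (e n)) *\<^sub>R e n) sums R f))"


section \<open>Gaussian measures\<close>

text \<open>\<open>\<sigma>\<close> is the standard deviation; the case \<open>\<sigma> = 0\<close> admits degenerate one-dimensional marginals.\<close>

definition normal_law :: "real \<Rightarrow> real \<Rightarrow> real measure" where
  "normal_law m \<sigma> =
     (if \<sigma> = 0 then return borel m else density lborel (normal_density m \<sigma>))"

definition gaussian_measure ::
    "('a::real_inner) measure \<Rightarrow> 'a \<Rightarrow> ('a \<Rightarrow> 'a) \<Rightarrow> bool" where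
  "gaussian_measure \<mu> m Q \<longleftrightarrow>
     sets \<mu> = sets borel \<and>
     (\<forall>h. \<exists>c \<sigma>. 0 \<le> \<sigma> \<and> distr \<mu> borel (\<lambda>x. inner x h) = normal_law c \<sigma>) \<and>
     (\<forall>h. (\<integral>x. inner x h \<partial>\<mu>) = inner m h) \<and>
     (\<forall>h k. (\<integral>x. inner (x - m) h * inner (x - m) k \<partial>\<mu>) = inner (Q h) k)"


section \<open>Total variation\<close>

text \<open>The total variation $\int_D |\nabla u|$ for a function $u$ whose gradient need only exist as a
  measure: the supremum over continuously differentiable vector fields of norm at most one with
  compact support in $D$. It depends only on the almost-everywhere class of \<open>u\<close>.\<close>

definition total_variation :: "(real ^ 'd::finite \<Rightarrow> real) \<Rightarrow> ereal" where
  "total_variation u =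
     (SUP \<phi> \<in> {\<phi> :: real ^ 'd \<Rightarrow> real ^ 'd. C1 \<phi> \<and> compact (closure {x. \<phi> x \<noteq> 0}) \<and>
                 closure {x. \<phi> x \<noteq> 0} \<subseteq> unit_cube \<and> (\<forall>x. norm (\<phi> x) \<le> 1)}.
        ereal (\<integral>x. u x * divergence \<phi> x \<partial>cube_measure))"

end

theory Submission
  imports Defs
begin

text \<open>The total variation of \<open>S(v)\<close> is twice the surface area of the zero set of \<open>v\<close>, and the
  Kac-Rice heuristic gives its expectation as
  \<open>2 \<integral> E[ |\<nabla>v(x)| given v(x) = 0 ] p\<^sub>x(0) dx\<close>, where \<open>p\<^sub>x\<close> is the density of \<open>v(x)\<close>.
  For a stationary Gaussian field \<open>v(x)\<close> and \<open>\<nabla>v(x)\<close> are independent, so this is at most a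
  constant times \<open>E |\<nabla>v(x)| / sd(v(x))\<close>. The Fourier mode of frequency \<open>k\<close> has variance of order
  \<open>|k|\<close> to the power \<open>-2\<alpha>\<close>, so \<open>E |\<nabla>v(x)|\<^sup>2\<close> is finite as soon as \<open>2\<alpha> - 2 > d\<close>, which is the
  hypothesis on \<open>\<alpha>\<close>. The zero mode alone keeps the variance of \<open>v(x)\<close> away from zero.

  Two regularisations make this rigorous: \<open>v\<close> is replaced by its partial Fourier sum
  \<open>v\<^sub>N\<close>, a trigonometric polynomial, and the threshold by the ramp \<open>arctan (m u)\<close>, which tends to
  \<open>\<pi>/2 \<cdot> sgn u\<close> and has slope \<open>m / (1 + (m u)\<^sup>2)\<close> of integral \<open>\<pi>\<close>. Integrating by parts against
  a test field bounds the pairing of \<open>arctan (m v\<^sub>N)\<close> with its divergence by an energy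
  \<open>\<integral> slope(v\<^sub>N) (1 + |\<nabla>v\<^sub>N|\<^sup>2)\<close> (\<open>integral_ramp_divergence_le\<close>). Its expectation is bounded
  uniformly in \<open>m\<close> and \<open>N\<close> (\<open>expected_ramp_energy_le\<close>), since \<open>v\<^sub>N(x)\<close> and \<open>\<nabla>v\<^sub>N(x)\<close> are
  uncorrelated jointly Gaussian (\<open>covariance_kernel\<close>, \<open>uncorrelated_gaussian_moment\<close>) and the
  spectrum is summable against \<open>|k|\<^sup>2\<close> (\<open>sum_spectrum_bounded\<close>). By Fatou's lemma the iterated
  lower limit of the energies is almost surely finite. For such a sample every pairing of \<open>S(v)\<close> with
  a test field is at most \<open>2/\<pi>\<close> times this lower limit, because the pairings converge when first
  \<open>N\<close> and then \<open>m\<close> tends to infinity (\<open>total_variation_sgn_le\<close>). The exceptional null set does not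
  depend on the test field or on the representative of \<open>v\<close>.

  Two facts connect the abstract hypotheses with Fourier series. Trigonometric polynomials are dense
  in \<open>L\<^sup>2\<close> (\<open>closure_span_modes\<close>), which gives \<open>v\<^sub>N \<longlonglongrightarrow> v\<close> for every sample and uniqueness of
  weak derivatives. The weak formulation tested with one mode shows that the solution operator, and
  hence its fractional power, acts on that mode as multiplication by a number
  (\<open>inner_covariance_mode\<close>).\<close>

section \<open>Integration over the unit cube\<close>

lemma unit_cube_eq_box: "(unit_cube :: (real ^ 'd::finite) set) = box 0 1"
  by (auto simp: unit_cube_def mem_box_cart)

lemma unit_cube_sets [measurable]: "(unit_cube :: (real ^ 'd::finite) set) \<in> sets borel"
  by (simp add: unit_cube_eq_box)

lemma emeasure_cube_measure: "emeasure (cube_measure :: (real ^ 'd::finite) measure) unit_cube = 1"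
proof -
  have "emeasure (cube_measure :: (real ^ 'd) measure) unit_cube = emeasure lborel (box 0 1 :: (real^'d) set)"
    by (simp add: emeasure_restrict_space unit_cube_eq_box)
  also have "\<dots> = 1"
    by (subst emeasure_lborel_box) (auto simp: Basis_vec_def inner_axis intro!: prod.neutral)
  finally show ?thesis .
qed

lemma measure_unit_cube [simp]: "measure (cube_measure :: (real ^ 'd::finite) measure) unit_cube = 1"
  by (simp add: measure_def emeasure_cube_measure)

lemma prob_space_cube_measure: "prob_space (cube_measure :: (real ^ 'd::finite) measure)"
  using emeasure_cube_measure by (intro prob_spaceI) (simp add: space_restrict_space)

interpretation cube: prob_space "cube_measure :: (real ^ 'd::finite) measure"
  by (rule prob_space_cube_measure)

lemma space_cube_measure [simp]: "space cube_measure = unit_cube"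
  by (simp add: space_restrict_space)

lemma continuous_measurable_cube:
  "continuous_on UNIV f \<Longrightarrow> f \<in> borel_measurable (cube_measure :: (real ^ 'd::finite) measure)"
  by (intro measurable_restrict_space1 measurable_completion)
     (simp add: borel_measurable_continuous_onI)

lemma bounded_image_closed_cube:
  fixes f :: "real ^ 'd::finite \<Rightarrow> real"
  assumes "continuous_on UNIV f"
  obtains B where "0 \<le> B" "\<And>x. x \<in> unit_cube \<Longrightarrow> \<bar>f x\<bar> \<le> B"
proof -
  have "compact (f ` cbox 0 1)"
    by (intro compact_continuous_image continuous_on_subset[OF assms]) auto
  then obtain B where B: "\<forall>x\<in>cbox 0 1. \<bar>f x\<bar> \<le> B"
    by (auto dest!: compact_imp_bounded simp: bounded_iff)
  moreover have "unit_cube \<subseteq> (cbox 0 1 :: (real ^ 'd) set)"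
    by (auto simp: unit_cube_def mem_box_cart less_imp_le)
  ultimately have "\<And>x. x \<in> unit_cube \<Longrightarrow> \<bar>f x\<bar> \<le> \<bar>B\<bar>"
    by force
  then show thesis using that[of "\<bar>B\<bar>"] by auto
qed

lemma continuous_integrable_cube:
  fixes f :: "real ^ 'd::finite \<Rightarrow> real"
  assumes "continuous_on UNIV f"
  shows "integrable cube_measure f"
proof -
  obtain B where "0 \<le> B" "\<And>x. x \<in> unit_cube \<Longrightarrow> \<bar>f x\<bar> \<le> B"
    using bounded_image_closed_cube[OF assms] by blast
  then show ?thesis
    using continuous_measurable_cube[OF assms]
    by (intro cube.integrable_const_bound[where B=B]) (auto intro!: AE_I2)
qed

lemma integral_cube_eq_lborel:
  fixes f :: "real ^ 'd::finite \<Rightarrow> real"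
  assumes "f \<in> borel_measurable borel"
  shows "integral\<^sup>L cube_measure f = integral\<^sup>L lborel (\<lambda>x. indicator unit_cube x *\<^sub>R f x)"
proof -
  have "integral\<^sup>L cube_measure f = integral\<^sup>L lebesgue (\<lambda>x. indicator unit_cube x *\<^sub>R f x)"
    by (subst integral_restrict_space) auto
  also have "\<dots> = integral\<^sup>L lborel (\<lambda>x. indicator unit_cube x *\<^sub>R f x)"
    by (rule integral_completion) (use assms in measurable)
  finally show ?thesis .
qed

text \<open>The common source of both integrations by parts, against periodic functions and against
  compactly supported fields: by Fubini the integral is taken first along lines in direction \<open>i\<close>,
  where the fundamental theorem of calculus leaves the difference of \<open>F\<close> over two opposite faces.
  The hypothesis on \<open>F\<close> concerns opposite points of the two faces, so it covers periodic functions as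
  well as functions that vanish there.\<close>

lemma integral_cube_partial_eq_0:
  fixes F F' :: "real ^ 'd::finite \<Rightarrow> real"
  assumes F': "continuous_on UNIV F'"
    and deriv: "\<And>x. ((\<lambda>t. F (x + t *\<^sub>R axis i 1)) has_real_derivative F' x) (at 0)"
    and faces: "\<And>x. x $ i = 0 \<Longrightarrow> (\<And>j. j \<noteq> i \<Longrightarrow> 0 < x $ j \<and> x $ j < 1) \<Longrightarrow> F (x + axis i 1) = F x"
  shows "integral\<^sup>L cube_measure F' = 0"
proof -
  let ?e = "axis i 1 :: real ^ 'd"
  define B where "B = Basis - {?e}"
  have B: "finite B" "?e \<notin> B" "insert ?e B = (Basis :: (real ^ 'd) set)"
    by (auto simp: B_def)
  interpret product_sigma_finite "\<lambda>b :: real ^ 'd. lborel :: real measure" ..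
  \<comment> \<open>Lebesgue measure is the image of a product of one-dimensional ones under this map.\<close>
  let ?s = "\<lambda>f. \<Sum>b\<in>Basis. f b *\<^sub>R b :: real ^ 'd"
  let ?G = "\<lambda>x :: real ^ 'd. indicator unit_cube x *\<^sub>R F' x"
  have [measurable]: "F' \<in> borel_measurable borel"
    using F' by (rule borel_measurable_continuous_onI)
  have int: "integrable lborel ?G"
  proof -
    have "integrable lborel (\<lambda>x. indicator (cbox 0 1) x *\<^sub>R F' x)"
      using F' by (intro borel_integrable_compact) (auto intro: continuous_on_subset)
    then have "integrable lborel (\<lambda>x. indicator unit_cube x *\<^sub>R (indicator (cbox 0 1) x *\<^sub>R F' x))"
      by (rule integrable_mult_indicator[rotated]) simp
    also have "(\<lambda>x. indicator unit_cube x *\<^sub>R (indicator (cbox 0 1) x *\<^sub>R F' x)) = ?G"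
      by (auto simp: fun_eq_iff unit_cube_def mem_box_cart less_imp_le split: split_indicator)
    finally show ?thesis .
  qed
  have line: "((\<lambda>y. F (x + y *\<^sub>R ?e)) has_real_derivative F' (x + y *\<^sub>R ?e)) (at y)" for x y
  proof -
    have "((\<lambda>t. F ((x + y *\<^sub>R ?e) + t *\<^sub>R ?e)) has_real_derivative F' (x + y *\<^sub>R ?e)) (at 0)"
      by (rule deriv)
    then have "((\<lambda>t. F (x + (t + y) *\<^sub>R ?e)) has_real_derivative F' (x + y *\<^sub>R ?e)) (at 0)"
      by (simp add: algebra_simps)
    then show ?thesis
      using DERIV_shift[of "\<lambda>t. F (x + t *\<^sub>R ?e)" _ 0 y] by (simp add: add.commute)
  qed
  have inner: "(\<integral>y. ?G (?s (f(?e := y))) \<partial>lborel) = 0" for f :: "real ^ 'd \<Rightarrow> real"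
  proof -
    define x where "x = (\<Sum>b\<in>B. f b *\<^sub>R b)"
    have s: "?s (f(?e := y)) = x + y *\<^sub>R ?e" for y
      unfolding B(3)[symmetric] x_def using B(1,2)
      by (auto simp: add.commute intro!: sum.cong)
    have "(f b *\<^sub>R b) $ i = 0" if b: "b \<in> B" for b
    proof -
      obtain j where "b = axis j 1" using b by (auto simp: B_def Basis_vec_def)
      moreover from this have "j \<noteq> i" using b by (auto simp: B_def)
      ultimately show ?thesis by (simp add: axis_def)
    qed
    then have xi: "x $ i = 0"
      unfolding x_def sum_component by (intro sum.neutral) blast
    have nth: "(x + y *\<^sub>R ?e) $ j = (if j = i then y else x $ j)" for y j
      using xi by (simp add: axis_def)
    show ?thesis
    proof (cases "\<forall>j. j \<noteq> i \<longrightarrow> 0 < x $ j \<and> x $ j < 1")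
      case True
      have "(\<integral>y. ?G (?s (f(?e := y))) \<partial>lborel) =
        (\<integral>y. indicator {0..1} y *\<^sub>R F' (x + y *\<^sub>R ?e) \<partial>lborel)"
      proof (rule integral_cong_AE)
        show "AE y in lborel. ?G (?s (f(?e := y))) = indicator {0..1} y *\<^sub>R F' (x + y *\<^sub>R ?e)"
          using AE_lborel_singleton[of "0::real"] AE_lborel_singleton[of "1::real"]
        proof eventually_elim
          case (elim y)
          then have "x + y *\<^sub>R ?e \<in> unit_cube \<longleftrightarrow> y \<in> {0..1}"
            using True unfolding unit_cube_def mem_Collect_eq nth by (auto simp: less_le)
          then show ?case unfolding s by (simp add: indicator_def)
        qed
      qed (auto simp: s)
      also have "\<dots> = F (x + 1 *\<^sub>R ?e) - F (x + 0 *\<^sub>R ?e)"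
      proof (rule integral_FTC_atLeastAtMost)
        show "((\<lambda>y. F (x + y *\<^sub>R ?e)) has_vector_derivative F' (x + y *\<^sub>R ?e)) (at y within {0..1})" for y
          using line[of x y]
          by (simp add: has_real_derivative_iff_has_vector_derivative has_vector_derivative_at_within)
        show "continuous_on {0..1} (\<lambda>y. F' (x + y *\<^sub>R ?e))"
          by (intro continuous_on_compose2[OF F'] continuous_intros) auto
      qed auto
      also have "\<dots> = 0" using faces[OF xi] True by simp
      finally show ?thesis .
    next
      case False
      then obtain j where "j \<noteq> i" "\<not> (0 < x $ j \<and> x $ j < 1)" by blast
      then have "x + y *\<^sub>R ?e \<notin> unit_cube" for y
        unfolding unit_cube_def mem_Collect_eq nth by metis
      then show ?thesis unfolding s by simp
    qed
  qed
  have "integral\<^sup>L cube_measure F' = integral\<^sup>L lborel ?G"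
    by (rule integral_cube_eq_lborel) simp
  also have "\<dots> = integral\<^sup>L (distr (\<Pi>\<^sub>M b\<in>Basis. lborel) borel ?s) ?G"
    by (subst lborel_eq) simp
  also have "\<dots> = (\<integral>f. ?G (?s f) \<partial>(\<Pi>\<^sub>M b\<in>Basis. lborel))"
    by (rule integral_distr) measurable
  also have "\<dots> = (\<integral>f. ?G (?s f) \<partial>(\<Pi>\<^sub>M b\<in>insert ?e B. lborel))"
    unfolding B(3) ..
  also have "\<dots> = (\<integral>f. (\<integral>y. ?G (?s (f(?e := y))) \<partial>lborel) \<partial>(\<Pi>\<^sub>M b\<in>B. lborel))"
  proof (rule product_integral_insert[OF B(1,2)])
    have "integrable (distr (\<Pi>\<^sub>M b\<in>Basis. lborel) borel ?s) ?G"
      using int by (subst (asm) lborel_eq) simp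
    then have "integrable (\<Pi>\<^sub>M b\<in>Basis. lborel) (\<lambda>f. ?G (?s f))"
      by (subst (asm) integrable_distr_eq) (auto simp del: scaleR_conv_of_real real_scaleR_def)
    then show "integrable (\<Pi>\<^sub>M b\<in>insert ?e B. lborel) (\<lambda>f. ?G (?s f))"
      unfolding B(3) .
  qed
  also have "\<dots> = 0" unfolding inner by simp
  finally show ?thesis .
qed

section \<open>Working with classes of square-integrable functions\<close>

lemma representative_exists:
  obtains w where "represents w f"
  using Quotient_rep_reflp[OF Quotient_l2, of f] Quotient_abs_rep[OF Quotient_l2, of f]
  by (auto simp: represents_def l2_class_def)

lemma inner_l2_class:
  "square_integrable f \<Longrightarrow> square_integrable g \<Longrightarrow>
    inner (l2_class f) (l2_class g) = (\<integral>x. f x * g x \<partial>cube_measure)"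
  unfolding l2_class_def by (rule inner_l2.abs_eq) auto

lemma l2_class_add:
  "square_integrable f \<Longrightarrow> square_integrable g \<Longrightarrow>
    l2_class (\<lambda>x. f x + g x) = l2_class f + l2_class g"
  unfolding l2_class_def by (rule plus_l2.abs_eq[symmetric]) auto

lemma l2_class_diff:
  "square_integrable f \<Longrightarrow> square_integrable g \<Longrightarrow>
    l2_class (\<lambda>x. f x - g x) = l2_class f - l2_class g"
  unfolding l2_class_def by (rule minus_l2.abs_eq[symmetric]) auto

lemma l2_class_scale:
  "square_integrable f \<Longrightarrow> l2_class (\<lambda>x. c * f x) = c *\<^sub>R l2_class f"
  unfolding l2_class_def by (rule scaleR_l2.abs_eq[symmetric]) auto

lemma l2_class_sum:
  assumes "finite I" "\<And>i. i \<in> I \<Longrightarrow> square_integrable (f i)"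
  shows "square_integrable (\<lambda>x. \<Sum>i\<in>I. f i x) \<and>
    l2_class (\<lambda>x. \<Sum>i\<in>I. f i x) = (\<Sum>i\<in>I. l2_class (f i))"
  using assms
proof (induction I)
  case empty
  then show ?case
    using square_integrable_zero by (simp add: l2_class_def zero_l2_def)
next
  case (insert i I)
  then show ?case by (simp add: square_integrable_add l2_class_add)
qed

lemma norm_l2_class_sq:
  "square_integrable f \<Longrightarrow> (norm (l2_class f))\<^sup>2 = (\<integral>x. (f x)\<^sup>2 \<partial>cube_measure)"
  unfolding power2_norm_eq_inner by (simp add: inner_l2_class power2_eq_square)

lemma square_integrable_bounded:
  assumes "f \<in> borel_measurable cube_measure" "\<And>x. x \<in> unit_cube \<Longrightarrow> \<bar>f x\<bar> \<le> B"
  shows "square_integrable f"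
  unfolding square_integrable_def
proof (intro conjI assms(1))
  have "(f x)\<^sup>2 \<le> B\<^sup>2" if "x \<in> unit_cube" for x
    using assms(2)[OF that] by (metis abs_ge_zero order_trans power2_abs power_mono)
  then show "integrable cube_measure (\<lambda>x. (f x)\<^sup>2)"
    using assms(1) by (intro cube.integrable_const_bound[where B="B\<^sup>2"]) (auto intro!: AE_I2)
qed

lemma square_integrable_continuous:
  assumes "continuous_on UNIV f"
  shows "square_integrable f"
proof -
  obtain B where "\<And>x. x \<in> unit_cube \<Longrightarrow> \<bar>f x\<bar> \<le> B"
    using bounded_image_closed_cube[OF assms] by blast
  then show ?thesis
    using continuous_measurable_cube[OF assms] by (intro square_integrable_bounded) auto
qed

lemma norm_l2_class_mono:
  assumes "square_integrable f" "square_integrable g" "\<And>x. x \<in> unit_cube \<Longrightarrow> \<bar>f x\<bar> \<le> c * \<bar>g x\<bar>" "0 \<le> c"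
  shows "norm (l2_class f) \<le> c * norm (l2_class g)"
proof (rule power2_le_imp_le)
  have "(norm (l2_class f))\<^sup>2 = (\<integral>x. (f x)\<^sup>2 \<partial>cube_measure)"
    by (rule norm_l2_class_sq) fact
  also have "\<dots> \<le> (\<integral>x. c\<^sup>2 * (g x)\<^sup>2 \<partial>cube_measure)"
  proof (rule integral_mono)
    fix x :: "real ^ 'a" assume "x \<in> space cube_measure"
    then have "\<bar>f x\<bar>\<^sup>2 \<le> (c * \<bar>g x\<bar>)\<^sup>2"
      using assms(3)[of x] by (intro power_mono) auto
    then show "(f x)\<^sup>2 \<le> c\<^sup>2 * (g x)\<^sup>2" by (simp add: power_mult_distrib)
  qed (use assms in \<open>auto simp: square_integrable_def\<close>)
  also have "\<dots> = (c * norm (l2_class g))\<^sup>2"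
    using assms by (simp add: norm_l2_class_sq power_mult_distrib)
  finally show "(norm (l2_class f))\<^sup>2 \<le> (c * norm (l2_class g))\<^sup>2" .
qed (use assms in simp)

lemma C1_continuous: "C1 f \<Longrightarrow> continuous_on UNIV f"
  unfolding C1_def
  by (intro continuous_at_imp_continuous_on ballI differentiable_imp_continuous_within) blast

lemma C1_continuous_partial: "C1 f \<Longrightarrow> continuous_on UNIV (partial_deriv i f)"
  by (simp add: C1_def partial_deriv_def[abs_def])

lemma C1_line_derivative:
  assumes "C1 f"
  shows "((\<lambda>t. f (x + t *\<^sub>R axis i 1)) has_vector_derivative partial_deriv i f x) (at 0)"
proof -
  let ?D = "frechet_derivative f (at x)"
  have D: "(f has_derivative ?D) (at x)"
    using assms by (simp add: C1_def frechet_derivative_works)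
  have "((\<lambda>t. x + t *\<^sub>R axis i 1) has_derivative (\<lambda>t. t *\<^sub>R axis i 1)) (at 0)"
    by (auto intro!: derivative_eq_intros)
  moreover have "(f has_derivative ?D) (at (x + 0 *\<^sub>R axis i 1))"
    using D by simp
  ultimately have "((\<lambda>t. f (x + t *\<^sub>R axis i 1)) has_derivative (\<lambda>t. ?D (t *\<^sub>R axis i 1))) (at 0)"
    by (rule has_derivative_compose)
  also have "(\<lambda>t. ?D (t *\<^sub>R axis i 1)) = (\<lambda>t. t *\<^sub>R ?D (axis i 1))"
    by (rule ext) (rule linear_scale[OF has_derivative_linear[OF D]])
  finally show ?thesis
    unfolding has_vector_derivative_def partial_deriv_def .
qed


section \<open>Trigonometric modes\<close>

definition phase :: "('d::finite \<Rightarrow> int) \<Rightarrow> real ^ 'd \<Rightarrow> real" where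
  "phase k x = 2 * pi * (\<Sum>i\<in>UNIV. of_int (k i) * x $ i)"

text \<open>A free phase \<open>\<theta>\<close> treats sines and cosines alike and turns differentiation into the shift
  \<open>\<theta> \<mapsto> \<theta> + \<pi>/2\<close>. The frequencies range over the whole lattice, so every real mode occurs for
  both \<open>k\<close> and \<open>- k\<close>; this redundancy provides exactly the factor 2 that makes the sums below
  orthogonal projections without further normalisation.\<close>

definition wave :: "('d::finite \<Rightarrow> int) \<Rightarrow> real \<Rightarrow> real ^ 'd \<Rightarrow> real" where
  "wave k \<theta> x = cos (phase k x + \<theta>)"

definition mode :: "('d::finite \<Rightarrow> int) \<Rightarrow> real \<Rightarrow> 'd l2" where
  "mode k \<theta> = l2_class (wave k \<theta>)"

lemma bounded_linear_phase: "bounded_linear (phase k)"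
  unfolding phase_def[abs_def]
  by (intro bounded_linear_const_mult bounded_linear_sum bounded_linear_vec_nth)

lemma phase_axis: "phase k (x + t *\<^sub>R axis i 1) = phase k x + 2 * pi * of_int (k i) * t"
proof -
  interpret bounded_linear "phase k" by (rule bounded_linear_phase)
  have "(\<Sum>j\<in>UNIV. of_int (k j) * axis i (1::real) $ j) = of_int (k i)"
    by (simp add: axis_def if_distrib sum.delta cong: if_cong)
  then have "phase k (axis i 1) = 2 * pi * of_int (k i)"
    by (simp add: phase_def)
  then show ?thesis by (simp add: add scaleR)
qed

lemma phase_uminus: "phase (\<lambda>i. - k i) x = - phase k x"
  by (simp add: phase_def sum_negf)

lemma phase_add: "phase (\<lambda>i. k i + l i) x = phase k x + phase l x"
  by (simp add: phase_def sum.distrib distrib_left distrib_right)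

lemma phase_diff: "phase (\<lambda>i. k i - l i) x = phase k x - phase l x"
  by (simp add: phase_def sum_subtractf right_diff_distrib left_diff_distrib)

lemma has_derivative_wave:
  "(wave k \<theta> has_derivative (\<lambda>h. phase k h * wave k (\<theta> + pi / 2) x)) (at x)"
proof -
  have "(phase k has_derivative phase k) (at x)"
    by (rule bounded_linear_imp_has_derivative) (rule bounded_linear_phase)
  then show ?thesis
    unfolding wave_def
    by (auto intro!: derivative_eq_intros simp: add.assoc[symmetric] minus_sin_cos_eq)
qed

lemma frechet_derivative_wave:
  "frechet_derivative (wave k \<theta>) (at x) = (\<lambda>h. phase k h * wave k (\<theta> + pi / 2) x)"
  by (rule frechet_derivative_at[symmetric]) (rule has_derivative_wave)

lemma continuous_wave: "continuous_on UNIV (wave k \<theta>)"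
  by (intro continuous_at_imp_continuous_on ballI has_derivative_continuous[OF has_derivative_wave])

lemma C1_wave: "C1 (wave k \<theta>)"
  unfolding C1_def
proof (intro conjI allI)
  show "wave k \<theta> differentiable (at x)" for x
    using has_derivative_wave by (rule differentiableI)
  show "continuous_on UNIV (\<lambda>x. frechet_derivative (wave k \<theta>) (at x) h)" for h
    unfolding frechet_derivative_wave by (intro continuous_intros continuous_wave)
qed

lemma partial_deriv_wave:
  "partial_deriv i (wave k \<theta>) = (\<lambda>x. 2 * pi * of_int (k i) * wave k (\<theta> + pi / 2) x)"
proof -
  have "phase k 0 = 0" by (simp add: phase_def)
  then have "phase k (axis i 1) = 2 * pi * of_int (k i)"
    using phase_axis[of k 0 1 i] by simp
  then show ?thesis
    by (simp add: partial_deriv_def[abs_def] frechet_derivative_wave)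
qed

lemma wave_line_derivative:
  "((\<lambda>t. wave k \<theta> (x + t *\<^sub>R axis i 1)) has_real_derivative
     2 * pi * of_int (k i) * wave k (\<theta> + pi / 2) x) (at 0)"
  using C1_line_derivative[OF C1_wave, of k \<theta> x i]
  unfolding partial_deriv_wave has_real_derivative_iff_has_vector_derivative .

lemma periodic_wave: "periodic (wave k \<theta>)"
proof -
  have "wave k \<theta> (x + axis i 1) = wave k \<theta> x" for x i
  proof -
    have "phase k (x + axis i 1) = phase k x + of_int (k i) * (2 * pi)"
      using phase_axis[of k x 1 i] by (simp add: mult.commute)
    then have eq: "phase k (x + axis i 1) + \<theta> = (phase k x + \<theta>) + of_int (k i) * (2 * pi)"
      by linarith
    show ?thesis
      unfolding wave_def eq using cos.plus_of_int[of "phase k x + \<theta>" "k i"] by simp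
  qed
  then show ?thesis by (simp add: periodic_def)
qed

lemma wave_mult:
  "wave k a x * wave l b x =
    (wave (\<lambda>i. k i + l i) (a + b) x + wave (\<lambda>i. k i - l i) (a - b) x) / 2"
proof -
  have "phase k x + phase l x + (a + b) = (phase k x + a) + (phase l x + b)"
    "phase k x - phase l x + (a - b) = (phase k x + a) - (phase l x + b)"
    by simp_all
  then show ?thesis
    unfolding wave_def phase_add phase_diff
    by (simp only: cos_times_cos add.commute[of "cos (phase k x + a - (phase l x + b))"])
qed

lemma square_integrable_wave: "square_integrable (wave k \<theta>)"
  by (rule square_integrable_continuous) (rule continuous_wave)

lemma integral_wave:
  "(\<integral>x. wave k \<theta> x \<partial>cube_measure) = (if k = (\<lambda>_. 0) then cos \<theta> else 0)"
proof (cases "k = (\<lambda>_. 0)")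
  case True
  then have "wave k \<theta> = (\<lambda>_. cos \<theta>)" by (simp add: wave_def phase_def fun_eq_iff)
  then show ?thesis using True by simp
next
  case False
  then obtain i where i: "k i \<noteq> 0" by auto
  have "integral\<^sup>L cube_measure (\<lambda>x. 2 * pi * of_int (k i) * wave k \<theta> x) = 0"
  proof (rule integral_cube_partial_eq_0)
    show "((\<lambda>t. wave k (\<theta> - pi / 2) (x + t *\<^sub>R axis i 1)) has_real_derivative
        2 * pi * of_int (k i) * wave k \<theta> x) (at 0)" for x
      using wave_line_derivative[of k "\<theta> - pi / 2" x i] by simp
    show "wave k (\<theta> - pi / 2) (x + axis i 1) = wave k (\<theta> - pi / 2) x" for x
      using periodic_wave[of k "\<theta> - pi / 2"] unfolding periodic_def by blast
  qed (intro continuous_intros continuous_wave)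
  then show ?thesis using i False by simp
qed

text \<open>By the product formula the inner product reduces to integrals of single waves, and these
  vanish unless the frequency does.\<close>

lemma inner_mode:
  "inner (mode k a) (mode l b) =
    ((if k = (\<lambda>i. - l i) then cos (a + b) else 0) + (if k = l then cos (a - b) else 0)) / 2"
proof -
  have "inner (mode k a) (mode l b) = (\<integral>x. wave k a x * wave l b x \<partial>cube_measure)"
    unfolding mode_def by (intro inner_l2_class square_integrable_wave)
  also have "\<dots> = ((\<integral>x. wave (\<lambda>i. k i + l i) (a + b) x \<partial>cube_measure) +
      (\<integral>x. wave (\<lambda>i. k i - l i) (a - b) x \<partial>cube_measure)) / 2"
    unfolding wave_mult
    by (simp add: continuous_integrable_cube continuous_wave)
  finally have "inner (mode k a) (mode l b) = \<dots>" .
  moreover have "(\<lambda>i. k i + l i) = (\<lambda>_. 0) \<longleftrightarrow> k = (\<lambda>i. - l i)"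
    by (simp add: fun_eq_iff eq_neg_iff_add_eq_0)
  moreover have "(\<lambda>i. k i - l i) = (\<lambda>_. 0) \<longleftrightarrow> k = l"
    by (simp add: fun_eq_iff)
  ultimately show ?thesis
    by (simp only: integral_wave)
qed

lemma wave_shift: "wave k \<theta> x = cos \<theta> * wave k 0 x + sin \<theta> * wave k (pi / 2) x"
  by (simp add: wave_def cos_add)

lemma mode_shift: "mode k \<theta> = cos \<theta> *\<^sub>R mode k 0 + sin \<theta> *\<^sub>R mode k (pi / 2)"
proof -
  have "wave k \<theta> = (\<lambda>x. cos \<theta> * wave k 0 x + sin \<theta> * wave k (pi / 2) x)"
    by (rule ext) (rule wave_shift)
  then show ?thesis
    by (simp add: mode_def l2_class_add l2_class_scale square_integrable_scale square_integrable_wave)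
qed

section \<open>Density of trigonometric polynomials\<close>

text \<open>Dominated convergence for the squared difference.\<close>

lemma l2_class_tendsto:
  fixes f :: "real ^ 'd::finite \<Rightarrow> real"
  assumes f: "square_integrable f" and g: "\<And>n. square_integrable (g n)"
    and h: "integrable cube_measure (\<lambda>x. (h x)\<^sup>2)"
    and bound: "\<And>n x. x \<in> unit_cube \<Longrightarrow> \<bar>g n x - f x\<bar> \<le> h x"
    and lim: "AE x in cube_measure. (\<lambda>n. g n x) \<longlonglongrightarrow> f x"
  shows "(\<lambda>n. l2_class (g n)) \<longlonglongrightarrow> l2_class f"
proof -
  have meas [measurable]: "f \<in> borel_measurable cube_measure" "\<And>n. g n \<in> borel_measurable cube_measure"
    using f g by (auto simp: square_integrable_def)
  have "(\<lambda>n. \<integral>x. (g n x - f x)\<^sup>2 \<partial>cube_measure) \<longlonglongrightarrow> (\<integral>x. 0 \<partial>(cube_measure :: (real ^ 'd) measure))"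
  proof (rule integral_dominated_convergence)
    show "AE x in cube_measure. (\<lambda>n. (g n x - f x)\<^sup>2) \<longlonglongrightarrow> 0"
      using lim by eventually_elim (auto intro!: tendsto_eq_intros)
    have "(g n x - f x)\<^sup>2 \<le> (h x)\<^sup>2" if "x \<in> unit_cube" for n x
      using bound[OF that, of n] by (metis abs_ge_zero power2_abs power_mono)
    then show "AE x in cube_measure. norm ((g n x - f x)\<^sup>2) \<le> (h x)\<^sup>2" for n
      by (auto intro!: AE_I2)
  qed (use h in measurable)
  then have "(\<lambda>n. (norm (l2_class (g n) - l2_class f))\<^sup>2) \<longlonglongrightarrow> 0"
    using f g by (simp add: l2_class_diff[symmetric] norm_l2_class_sq square_integrable_diff)
  then have "(\<lambda>n. norm (l2_class (g n) - l2_class f)) \<longlonglongrightarrow> 0"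
    using tendsto_real_sqrt by fastforce
  from tendsto_norm_zero_cancel[OF this] show ?thesis
    by (rule LIM_zero_cancel)
qed

text \<open>Phases and scalar factors are absorbed into the generators, so that closure under products,
  as required by the Stone-Weierstrass theorem, follows by two inductions from the product formula.\<close>

inductive trig_poly :: "(real ^ 'd::finite \<Rightarrow> real) \<Rightarrow> bool" where
  wave: "trig_poly (\<lambda>x. c * wave k \<theta> x)"
| add: "trig_poly f \<Longrightarrow> trig_poly g \<Longrightarrow> trig_poly (\<lambda>x. f x + g x)"

lemma trig_poly_wave_mult:
  "trig_poly g \<Longrightarrow> trig_poly (\<lambda>x. (c * wave k \<theta> x) * g x)"
proof (induction rule: trig_poly.induct)
  case (wave c' l \<eta>)
  have "(\<lambda>x. (c * wave k \<theta> x) * (c' * wave l \<eta> x)) =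
    (\<lambda>x. (c * c' / 2) * wave (\<lambda>i. k i + l i) (\<theta> + \<eta>) x + (c * c' / 2) * wave (\<lambda>i. k i - l i) (\<theta> - \<eta>) x)"
    using wave_mult[of k \<theta> _ l \<eta>] by (simp add: fun_eq_iff field_simps)
  then show ?case by (simp only:) (intro trig_poly.intros)
next
  case (add f g)
  then show ?case by (simp only: distrib_left trig_poly.add)
qed

lemma trig_poly_mult: "trig_poly f \<Longrightarrow> trig_poly g \<Longrightarrow> trig_poly (\<lambda>x. f x * g x)"
proof (induction rule: trig_poly.induct)
  case (add f f')
  then show ?case by (simp only: distrib_right trig_poly.add)
qed (rule trig_poly_wave_mult)

lemma trig_poly_continuous: "trig_poly p \<Longrightarrow> continuous_on UNIV p"
  by (induction rule: trig_poly.induct) (auto intro!: continuous_intros continuous_wave)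

lemma trig_poly_square_integrable: "trig_poly p \<Longrightarrow> square_integrable p"
  by (intro square_integrable_continuous trig_poly_continuous)

lemma trig_poly_in_span: "trig_poly p \<Longrightarrow> l2_class p \<in> span (range (case_prod mode))"
proof (induction rule: trig_poly.induct)
  case (wave c k \<theta>)
  have "mode k \<theta> \<in> range (case_prod mode)" by force
  then show ?case
    by (simp add: l2_class_scale square_integrable_wave span_scale span_base flip: mode_def)
next
  case (add f g)
  then show ?case
    by (simp add: l2_class_add trig_poly_square_integrable span_add)
qed

lemma trig_poly_const: "trig_poly (\<lambda>x. c)"
  using trig_poly.wave[of c "\<lambda>_. 0" 0] by (simp add: wave_def phase_def)

text \<open>Two points of the closed unit interval are identified on the circle only if both are
  endpoints.\<close>

lemma cis_eq_imp_endpoints: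
  fixes x y :: real
  assumes "cis (2 * pi * x) = cis (2 * pi * y)" "x \<in> {0..1}" "y \<in> {0..1}" "x \<noteq> y"
  shows "x \<notin> {0<..<1} \<and> y \<notin> {0<..<1}"
proof -
  have "sin (2 * pi * x) = sin (2 * pi * y) \<and> cos (2 * pi * x) = cos (2 * pi * y)"
    using assms(1) by (simp add: cis.ctr complex_eq_iff)
  then obtain n :: int where "2 * pi * x = 2 * pi * y + 2 * pi * n"
    unfolding sin_cos_eq_iff by blast
  then have "2 * pi * (x - y) = 2 * pi * n"
    by (simp add: algebra_simps)
  then have n: "x - y = n" by simp
  then have "\<bar>n\<bar> \<le> 1" "n \<noteq> 0" using assms by auto
  then have "n = 1 \<or> n = -1" by linarith
  then show ?thesis using n assms by auto
qed

text \<open>Trigonometric polynomials do not separate opposite boundary points of the closed cube. The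
  approximation therefore takes place on the torus \<open>E ` K\<close> inside a complex coordinate space:
  \<open>G\<close> vanishes on the boundary, so it factors as \<open>F \<circ> E\<close>, and \<open>F\<close> is continuous because
  \<open>E\<close> maps the compact cube onto a Hausdorff space and is therefore a closed map.\<close>

lemma trig_poly_approximates:
  fixes G :: "real ^ 'd::finite \<Rightarrow> real"
  assumes G: "continuous_on UNIV G" and vanish: "\<And>x. x \<notin> unit_cube \<Longrightarrow> G x = 0" and e: "0 < e"
  shows "\<exists>p. trig_poly p \<and> (\<forall>x \<in> unit_cube. \<bar>G x - p x\<bar> < e)"
proof -
  define K where "K = (cbox 0 1 :: (real ^ 'd) set)"
  define E where "E = (\<lambda>x :: real ^ 'd. \<chi> i. cis (2 * pi * x $ i))"
  define F where "F z = G (SOME x. x \<in> K \<and> E x = z)" for z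
  have K: "x \<in> K \<longleftrightarrow> (\<forall>i. x $ i \<in> {0..1})" for x
    by (simp add: K_def mem_box_cart)
  have contE: "continuous_on A E" for A
    unfolding E_def by (intro continuous_intros)
  have FE: "F (E x) = G x" if "x \<in> K" for x
  proof -
    define y where "y = (SOME y. y \<in> K \<and> E y = E x)"
    have "\<exists>y. y \<in> K \<and> E y = E x" using that by blast
    then have "y \<in> K \<and> E y = E x"
      unfolding y_def by (rule someI_ex)
    then have y: "y \<in> K" "E y = E x" by auto
    have "G y = G x"
    proof (cases "y = x")
      case False
      then obtain i where i: "y $ i \<noteq> x $ i" by (auto simp: vec_eq_iff)
      have "cis (2 * pi * y $ i) = cis (2 * pi * x $ i)"
        using y(2) by (simp add: E_def vec_eq_iff)
      then have "y $ i \<notin> {0<..<1} \<and> x $ i \<notin> {0<..<1}"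
        using y(1) that i unfolding K by (intro cis_eq_imp_endpoints) auto
      then have "y \<notin> unit_cube" "x \<notin> unit_cube" by (auto simp: unit_cube_def)
      then show ?thesis by (simp add: vanish)
    qed simp
    then show ?thesis by (simp add: F_def y_def)
  qed
  have "\<exists>g. (continuous_on (E ` K) g \<and> trig_poly (\<lambda>x. g (E x))) \<and> (\<forall>z\<in>E ` K. \<bar>F z - g z\<bar> < e)"
  proof (rule Stone_Weierstrass_HOL)
    show "compact (E ` K)"
      by (intro compact_continuous_image contE) (simp add: K_def)
    show "continuous_on (E ` K) F"
    proof (subst continuous_on_closed_vimage)
      show "closed (E ` K)" by (rule compact_imp_closed) fact
      show "\<forall>B. closed B \<longrightarrow> closed (F -` B \<inter> E ` K)"
      proof (intro allI impI)
        fix B :: "real set" assume "closed B"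
        then have "closed (G -` B)"
          using G by (simp add: continuous_on_closed_vimage)
        then have "compact (G -` B \<inter> K)"
          unfolding K_def by (intro closed_Int_compact) auto
        then have "compact (E ` (G -` B \<inter> K))"
          by (intro compact_continuous_image contE)
        moreover have "F -` B \<inter> E ` K = E ` (G -` B \<inter> K)"
          using FE by auto
        ultimately show "closed (F -` B \<inter> E ` K)"
          by (simp add: compact_imp_closed)
      qed
    qed
    fix z w assume "z \<in> E ` K \<and> w \<in> E ` K \<and> z \<noteq> w"
    then obtain i where "z $ i \<noteq> w $ i" by (auto simp: vec_eq_iff)
    then have "Re (z $ i) \<noteq> Re (w $ i) \<or> Im (z $ i) \<noteq> Im (w $ i)"
      by (simp add: complex_eq_iff)
    moreover have "phase (\<lambda>j. if j = i then 1 else 0) x = 2 * pi * x $ i" for x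
    proof -
      have "(\<Sum>j\<in>UNIV. of_int (if j = i then 1 else 0) * x $ j) = (\<Sum>j\<in>UNIV. if j = i then x $ j else 0)"
        by (intro sum.cong) auto
      then show ?thesis by (simp add: phase_def)
    qed
    then have "(\<lambda>x. Re (E x $ i)) = (\<lambda>x. 1 * wave (\<lambda>j. if j = i then 1 else 0) 0 x)"
      and "(\<lambda>x. Im (E x $ i)) = (\<lambda>x. 1 * wave (\<lambda>j. if j = i then 1 else 0) (- pi / 2) x)"
      by (simp_all add: E_def wave_def cos_sin_eq[of "_ - _"])
    then have "trig_poly (\<lambda>x. Re (E x $ i))" "trig_poly (\<lambda>x. Im (E x $ i))"
      by (simp_all only: trig_poly.wave)
    moreover have "continuous_on (E ` K) (\<lambda>z. Re (z $ i))" "continuous_on (E ` K) (\<lambda>z. Im (z $ i))"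
      by (intro continuous_intros)+
    ultimately show "\<exists>f. (continuous_on (E ` K) f \<and> trig_poly (\<lambda>x. f (E x))) \<and> f z \<noteq> f w"
      by blast
  qed (auto intro!: continuous_intros trig_poly_const trig_poly.add trig_poly_mult e)
  then obtain g where "trig_poly (\<lambda>x. g (E x))" "\<forall>z\<in>E ` K. \<bar>F z - g z\<bar> < e" by blast
  moreover have "x \<in> K" if "x \<in> unit_cube" for x
    using that by (simp add: K unit_cube_def less_imp_le)
  ultimately show ?thesis using FE by (intro exI[of _ "\<lambda>x. g (E x)"]) fastforce
qed

text \<open>A measurable function is an almost everywhere limit of continuous ones. Clipping these at
  the bound of \<open>f\<close> makes dominated convergence applicable, and the factor \<open>\<rho> n\<close> makes them
  vanish on the boundary of the cube.\<close>

lemma bounded_in_closure_span_modes: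
  fixes f :: "real ^ 'd::finite \<Rightarrow> real"
  assumes f: "f \<in> borel_measurable cube_measure" and B: "\<And>x. x \<in> unit_cube \<Longrightarrow> \<bar>f x\<bar> \<le> B"
  shows "l2_class f \<in> closure (span (range (case_prod mode)))" (is "_ \<in> closure ?S")
proof -
  have "(\<lambda>x. if x \<in> unit_cube then f x else 0) \<in> borel_measurable lebesgue"
    using f by (subst borel_measurable_if) auto
  then have "(\<lambda>x. if x \<in> unit_cube then f x else 0) measurable_on UNIV"
    by (rule lebesgue_measurable_imp_measurable_on_real) simp
  then obtain N g where N: "negligible N" and g: "\<And>n. continuous_on UNIV (g n)"
    and lim: "\<And>x. x \<notin> N \<Longrightarrow> (\<lambda>n. g n x) \<longlonglongrightarrow> (if x \<in> unit_cube then f x else 0)"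
    unfolding measurable_on_def by auto
  define clip where "clip t = max (- B) (min B t)" for t
  define \<rho> where "\<rho> n x = min 1 (real n * infdist x (- unit_cube))" for n and x :: "real ^ 'd"
  define G where "G n x = \<rho> n x * clip (g n x)" for n x
  have Bpos: "0 \<le> B"
  proof -
    have "(\<chi> i. 1 / 2) \<in> (unit_cube :: (real ^ 'd) set)" by (simp add: unit_cube_def)
    from B[OF this] show ?thesis by linarith
  qed
  have contG: "continuous_on UNIV (G n)" for n
    unfolding G_def \<rho>_def clip_def
    by (intro continuous_intros g continuous_on_infdist) 
  have vanish: "G n x = 0" if "x \<notin> unit_cube" for n x
    using that by (simp add: G_def \<rho>_def)
  have bound: "\<bar>G n x\<bar> \<le> B" for n x
  proof -
    have "0 \<le> \<rho> n x" "\<rho> n x \<le> 1" by (auto simp: \<rho>_def infdist_nonneg)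
    moreover have "\<bar>clip (g n x)\<bar> \<le> B" using Bpos by (auto simp: clip_def)
    ultimately show ?thesis using mult_mono[of "\<rho> n x" 1 "\<bar>clip (g n x)\<bar>" B]
      by (simp add: G_def abs_mult)
  qed
  have "(\<lambda>n. G n x) \<longlonglongrightarrow> f x" if "x \<in> unit_cube" "x \<notin> N" for x
  proof -
    have "infdist x (- unit_cube) > 0"
    proof -
      have "closed (- unit_cube :: (real ^ 'd) set)"
        by (simp add: unit_cube_eq_box closed_Compl open_box)
      moreover have "0 \<notin> (unit_cube :: (real ^ 'd) set)" by (simp add: unit_cube_def)
      then have "(- unit_cube :: (real ^ 'd) set) \<noteq> {}" by blast
      ultimately show ?thesis
        using that in_closed_iff_infdist_zero[of "- unit_cube" x] infdist_nonneg[of x "- unit_cube"]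
        by fastforce
    qed
    then have "eventually (\<lambda>n. \<rho> n x = 1) sequentially"
    proof -
      obtain m :: nat where m: "1 < real m * infdist x (- unit_cube)"
        using reals_Archimedean3[OF \<open>infdist x (- unit_cube) > 0\<close>] by blast
      have "1 \<le> real n * infdist x (- unit_cube)" if "m \<le> n" for n
        using m mult_right_mono[of "real m" "real n" "infdist x (- unit_cube)"] that
        by (simp add: infdist_nonneg)
      then have "eventually (\<lambda>n. 1 \<le> real n * infdist x (- unit_cube)) sequentially"
        unfolding eventually_sequentially by blast
      then show ?thesis by eventually_elim (simp add: \<rho>_def)
    qed
    then have "(\<lambda>n. \<rho> n x) \<longlonglongrightarrow> 1" by (rule tendsto_eventually)
    moreover have "(\<lambda>n. clip (g n x)) \<longlonglongrightarrow> clip (f x)"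
      unfolding clip_def using lim[OF that(2)] that(1) by (intro tendsto_intros) simp
    moreover have "clip (f x) = f x" using B[OF that(1)] by (auto simp: clip_def)
    ultimately show ?thesis
      unfolding G_def using tendsto_mult by fastforce
  qed
  moreover have "AE x in lebesgue. x \<notin> N"
    using N by (intro AE_not_in) (simp add: negligible_iff_null_sets)
  ultimately have "AE x in lebesgue. x \<in> unit_cube \<longrightarrow> (\<lambda>n. G n x) \<longlonglongrightarrow> f x"
    by (auto elim: eventually_mono)
  then have lim: "AE x in cube_measure. (\<lambda>n. G n x) \<longlonglongrightarrow> f x"
    by (subst AE_restrict_space_iff) auto
  have "(\<lambda>n. l2_class (G n)) \<longlonglongrightarrow> l2_class f"
  proof (rule l2_class_tendsto)
    show "square_integrable f" using f B by (rule square_integrable_bounded)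
    show "square_integrable (G n)" for n by (rule square_integrable_continuous) (rule contG)
    show "\<bar>G n x - f x\<bar> \<le> 2 * B" if "x \<in> unit_cube" for n x
      using bound[of n x] B[OF that] by linarith
  qed (use lim in auto)
  moreover have "l2_class (G n) \<in> closure ?S" for n
  proof (subst closure_approachable, intro allI impI)
    fix e :: real assume "0 < e"
    obtain p where p: "trig_poly p" "\<And>x. x \<in> unit_cube \<Longrightarrow> \<bar>G n x - p x\<bar> < e / 2"
      using trig_poly_approximates[OF contG[of n] vanish[of _ n], of "e / 2"] \<open>0 < e\<close> by auto
    have sq: "square_integrable p" "square_integrable (G n)" "square_integrable (\<lambda>x :: real ^ 'd. 1)"
      using p(1) contG[of n] by (auto intro: trig_poly_square_integrable square_integrable_continuous)
    have "norm (l2_class (\<lambda>x. p x - G n x)) \<le> e / 2 * norm (l2_class (\<lambda>x :: real ^ 'd. 1))"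
    proof (rule norm_l2_class_mono)
      show "\<bar>p x - G n x\<bar> \<le> e / 2 * \<bar>1\<bar>" if "x \<in> unit_cube" for x
        using p(2)[OF that] by (simp add: abs_minus_commute)
    qed (use \<open>0 < e\<close> in \<open>simp_all add: sq square_integrable_diff[OF sq(1,2)]\<close>)
    moreover have "norm (l2_class (\<lambda>x :: real ^ 'd. 1)) = 1"
    proof (rule power2_eq_imp_eq)
      show "(norm (l2_class (\<lambda>x :: real ^ 'd. 1)))\<^sup>2 = 1\<^sup>2"
        unfolding norm_l2_class_sq[OF sq(3)] by simp
    qed auto
    ultimately have "dist (l2_class p) (l2_class (G n)) < e"
      unfolding dist_norm l2_class_diff[OF sq(1,2), symmetric] using \<open>0 < e\<close> by simp
    then show "\<exists>y\<in>?S. dist y (l2_class (G n)) < e"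
      using trig_poly_in_span[OF p(1)] by blast
  qed
  ultimately show ?thesis
    using closed_sequentially[OF closed_closure] by metis
qed

text \<open>Truncation reduces the general case to bounded functions.\<close>

lemma closure_span_modes: "closure (span (range (case_prod mode))) = (UNIV :: 'd::finite l2 set)"
proof -
  have "v \<in> closure (span (range (case_prod mode)))" for v :: "'d l2"
  proof -
    obtain f where f: "square_integrable f" "l2_class f = v"
      using representative_exists[of v] by (auto simp: represents_def)
    define g where "g n x = max (- real n) (min (real n) (f x))" for n x
    have [measurable]: "f \<in> borel_measurable cube_measure"
      using f by (simp add: square_integrable_def)
    have meas: "g n \<in> borel_measurable cube_measure" for n
      unfolding g_def by measurable
    have bd: "\<bar>g n x\<bar> \<le> real n" for n x by (auto simp: g_def)
    have "(\<lambda>n. l2_class (g n)) \<longlonglongrightarrow> l2_class f"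
    proof (rule l2_class_tendsto)
      show "square_integrable (g n)" for n
        using meas bd by (rule square_integrable_bounded)
      show "integrable cube_measure (\<lambda>x. \<bar>f x\<bar>\<^sup>2)"
        using f(1) by (simp add: square_integrable_def)
      show "\<bar>g n x - f x\<bar> \<le> \<bar>f x\<bar>" for n x by (auto simp: g_def)
      have "(\<lambda>n. g n x) \<longlonglongrightarrow> f x" for x
      proof (rule tendsto_eventually)
        obtain n0 :: nat where "\<bar>f x\<bar> \<le> n0" using real_arch_simple by blast
        then show "eventually (\<lambda>n. g n x = f x) sequentially"
          unfolding eventually_sequentially by (intro exI[of _ n0]) (auto simp: g_def)
      qed
      then show "AE x in cube_measure. (\<lambda>n. g n x) \<longlonglongrightarrow> f x" by simp
    qed (rule f)
    moreover have "l2_class (g n) \<in> closure (span (range (case_prod mode)))" for n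
      using meas bd by (rule bounded_in_closure_span_modes)
    ultimately show ?thesis
      using closed_sequentially[OF closed_closure] f(2) by metis
  qed
  then show ?thesis by blast
qed

section \<open>The covariance operator acts diagonally on modes\<close>

text \<open>Density of the modes in the form in which it identifies elements of \<open>L\<^sup>2\<close>; in particular
  it makes weak derivatives unique.\<close>

lemma orthogonal_modes_imp_0:
  assumes "\<And>k \<theta>. inner f (mode k \<theta>) = 0"
  shows "f = 0"
proof -
  let ?N = "{g. inner f g = 0}"
  have "span (range (case_prod mode)) \<subseteq> ?N"
    using assms by (intro span_minimal) (auto simp: subspace_def inner_add_right)
  moreover have "closed ?N"
    by (intro closed_Collect_eq continuous_intros)
  ultimately have "closure (span (range (case_prod mode))) \<subseteq> ?N"
    by (rule closure_minimal)
  then have "f \<in> ?N" unfolding closure_span_modes by blast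
  then show ?thesis by simp
qed

lemma mode_pi: "mode k (pi + \<theta>) = - mode k \<theta>"
proof -
  have "wave k (pi + \<theta>) = (\<lambda>x. (-1) * wave k \<theta> x)"
    using cos_periodic_pi by (simp add: fun_eq_iff wave_def ac_simps)
  then show ?thesis
    unfolding mode_def by (simp only: l2_class_scale square_integrable_wave scaleR_minus1_left)
qed

text \<open>Integration by parts applied to the product of the wave with a periodic test function.\<close>

lemma has_weak_partial_mode:
  "has_weak_partial i (c *\<^sub>R mode k \<theta>) ((c * (2 * pi * of_int (k i))) *\<^sub>R mode k (\<theta> + pi / 2))"
  unfolding has_weak_partial_def
proof (intro allI impI)
  fix \<psi> :: "real ^ 'a \<Rightarrow> real" assume C1: "C1 \<psi>" and per: "periodic \<psi>"
  let ?a = "2 * pi * real_of_int (k i)"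
  note cont = continuous_wave C1_continuous[OF C1] C1_continuous_partial[OF C1]
  have "(\<integral>x. wave k \<theta> x * partial_deriv i \<psi> x + ?a * wave k (\<theta> + pi / 2) x * \<psi> x \<partial>cube_measure) = 0"
  proof (rule integral_cube_partial_eq_0)
    show "((\<lambda>t. wave k \<theta> (x + t *\<^sub>R axis i 1) * \<psi> (x + t *\<^sub>R axis i 1)) has_real_derivative
        wave k \<theta> x * partial_deriv i \<psi> x + ?a * wave k (\<theta> + pi / 2) x * \<psi> x) (at 0)" for x
      using DERIV_mult[OF wave_line_derivative[of k \<theta> x i], of "\<lambda>t. \<psi> (x + t *\<^sub>R axis i 1)" "partial_deriv i \<psi> x"]
        C1_line_derivative[OF C1, of x i]
      by (simp add: has_real_derivative_iff_has_vector_derivative add.commute mult.commute)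
    show "wave k \<theta> (x + axis i 1) * \<psi> (x + axis i 1) = wave k \<theta> x * \<psi> x" for x
      using periodic_wave[of k \<theta>] per by (simp add: periodic_def)
    show "continuous_on UNIV (\<lambda>x. wave k \<theta> x * partial_deriv i \<psi> x + ?a * wave k (\<theta> + pi / 2) x * \<psi> x)"
      by (intro continuous_intros cont)
  qed
  moreover have "integrable cube_measure (\<lambda>x. wave k \<theta> x * partial_deriv i \<psi> x)"
    "integrable cube_measure (\<lambda>x. ?a * (wave k (\<theta> + pi / 2) x * \<psi> x))"
    by (intro continuous_integrable_cube continuous_intros cont)+
  ultimately have "(\<integral>x. wave k \<theta> x * partial_deriv i \<psi> x \<partial>cube_measure) +
      (\<integral>x. ?a * (wave k (\<theta> + pi / 2) x * \<psi> x) \<partial>cube_measure) = 0"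
    by (simp add: mult.assoc)
  then have "inner (mode k \<theta>) (l2_class (partial_deriv i \<psi>)) +
      ?a * inner (mode k (\<theta> + pi / 2)) (l2_class \<psi>) = 0"
    unfolding mode_def
    by (simp add: inner_l2_class square_integrable_continuous cont)
  then have "c * (inner (mode k \<theta>) (l2_class (partial_deriv i \<psi>)) +
      ?a * inner (mode k (\<theta> + pi / 2)) (l2_class \<psi>)) = 0" by simp
  then show "inner (c *\<^sub>R mode k \<theta>) (l2_class (partial_deriv i \<psi>)) =
      - inner ((c * ?a) *\<^sub>R mode k (\<theta> + pi / 2)) (l2_class \<psi>)"
    by (simp add: algebra_simps)
qed

lemma scaled_mode_in_sobolev: "c *\<^sub>R mode k \<theta> \<in> periodic_sobolev n"
proof (induction n arbitrary: c \<theta>)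
  case (Suc n)
  show ?case
    unfolding periodic_sobolev.simps using has_weak_partial_mode Suc.IH by blast
qed simp

text \<open>Modes are admissible test functions, so the Fourier coefficients of a weak derivative are
  determined by those of the function.\<close>

lemma inner_weak_partial_mode:
  assumes "has_weak_partial i f g"
  shows "inner g (mode k \<theta>) = - (2 * pi * of_int (k i)) * inner f (mode k (\<theta> + pi / 2))"
proof -
  have "l2_class (partial_deriv i (wave k \<theta>)) = (2 * pi * of_int (k i)) *\<^sub>R mode k (\<theta> + pi / 2)"
    unfolding partial_deriv_wave mode_def by (rule l2_class_scale) (rule square_integrable_wave)
  moreover have "inner f (l2_class (partial_deriv i (wave k \<theta>))) = - inner g (l2_class (wave k \<theta>))"
    using assms C1_wave[of k \<theta>] periodic_wave[of k \<theta>] unfolding has_weak_partial_def by blast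
  ultimately show ?thesis by (simp add: mode_def)
qed

lemma weak_partial_eq:
  assumes "has_weak_partial i f g"
  shows "weak_partial i f = g"
  unfolding weak_partial_def
proof (rule the_equality)
  fix h assume "has_weak_partial i f h"
  then have "inner (h - g) (mode k \<theta>) = 0" for k \<theta>
    using inner_weak_partial_mode[OF assms] inner_weak_partial_mode[of i f h]
    by (simp add: inner_diff_left)
  then show "h = g" using orthogonal_modes_imp_0[of "h - g"] by simp
qed fact

definition freq_sq :: "('d::finite \<Rightarrow> int) \<Rightarrow> real" where
  "freq_sq k = (\<Sum>i\<in>UNIV. (2 * pi * of_int (k i))\<^sup>2)"

text \<open>The Fourier multiplier of the elliptic operator.\<close>

definition symbol :: "real \<Rightarrow> real \<Rightarrow> real \<Rightarrow> real \<Rightarrow> real \<Rightarrow> real \<Rightarrow> real \<Rightarrow> ('d::finite \<Rightarrow> int) \<Rightarrow> real" where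
  "symbol \<delta> \<epsilon> q \<tau> a1 a2 a3 k = \<delta> * \<epsilon> powr (- 2 * a1) * (freq_sq k)\<^sup>2
     + q * \<delta> * \<epsilon> powr (- 2 * a2) * freq_sq k + \<tau>\<^sup>2 * \<delta> * \<epsilon> powr (- 2 * a3)"

lemma weak_partial_mode:
  "weak_partial i (c *\<^sub>R mode k \<theta>) = (c * (2 * pi * of_int (k i))) *\<^sub>R mode k (\<theta> + pi / 2)"
  by (rule weak_partial_eq) (rule has_weak_partial_mode)

lemma weak_laplacian_mode: "weak_laplacian (mode k \<theta>) = - freq_sq k *\<^sub>R mode k \<theta>"
proof -
  have "weak_partial i (weak_partial i (mode k \<theta>)) = - ((2 * pi * of_int (k i))\<^sup>2 *\<^sub>R mode k \<theta>)" for i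
    using weak_partial_mode[of i 1 k \<theta>]
    by (simp add: weak_partial_mode mode_pi power2_eq_square)
  then show ?thesis
    by (simp add: weak_laplacian_def freq_sq_def sum_negf scaleR_sum_left)
qed

text \<open>Testing the weak formulation with a mode moves all derivatives onto the mode. On
  Fourier coefficients the elliptic operator is therefore multiplication by its symbol.\<close>

lemma inner_weak_solution_mode:
  assumes "weak_solution \<delta> \<epsilon> q \<tau> a1 a2 a3 f \<eta>"
  shows "symbol \<delta> \<epsilon> q \<tau> a1 a2 a3 k * inner \<eta> (mode k \<theta>) = inner f (mode k \<theta>)"
proof -
  have "\<exists>g. has_weak_partial i \<eta> g \<and> (\<exists>h. has_weak_partial i g h)" for i
    using assms by (force simp: weak_solution_def numeral_2_eq_2)
  then obtain g h where g: "\<And>i. has_weak_partial i \<eta> (g i)" and h: "\<And>i. has_weak_partial i (g i) (h i)"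
    by metis
  have wp: "weak_partial i \<eta> = g i" "weak_partial i (g i) = h i" for i
    using g h by (auto intro: weak_partial_eq)
  have first: "inner (g i) (weak_partial i (mode k \<theta>)) = (2 * pi * of_int (k i))\<^sup>2 * inner \<eta> (mode k \<theta>)" for i
    using weak_partial_mode[of i 1 k \<theta>] inner_weak_partial_mode[OF g, of i k "\<theta> + pi / 2"]
    by (simp add: mode_pi power2_eq_square)
  have "inner (h i) (mode k \<theta>) = - ((2 * pi * of_int (k i))\<^sup>2 * inner \<eta> (mode k \<theta>))" for i
    using inner_weak_partial_mode[OF h, of i k \<theta>] inner_weak_partial_mode[OF g, of i k "\<theta> + pi / 2"]
    by (simp add: mode_pi power2_eq_square)
  then have "inner (weak_laplacian \<eta>) (mode k \<theta>) = - (freq_sq k * inner \<eta> (mode k \<theta>))"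
    by (simp add: weak_laplacian_def wp inner_sum_left freq_sq_def sum_distrib_right sum_negf)
  moreover have "(\<Sum>i\<in>UNIV. inner (g i) (weak_partial i (mode k \<theta>))) = freq_sq k * inner \<eta> (mode k \<theta>)"
    by (simp add: first freq_sq_def sum_distrib_right)
  moreover have "mode k \<theta> \<in> periodic_sobolev 2"
    using scaled_mode_in_sobolev[of 1 k \<theta> 2] by simp
  moreover from this assms have "\<delta> * \<epsilon> powr (- 2 * a1) * inner (weak_laplacian \<eta>) (weak_laplacian (mode k \<theta>))
        + q * \<delta> * \<epsilon> powr (- 2 * a2) * (\<Sum>i\<in>UNIV. inner (g i) (weak_partial i (mode k \<theta>)))
        + \<tau>\<^sup>2 * \<delta> * \<epsilon> powr (- 2 * a3) * inner \<eta> (mode k \<theta>) = inner f (mode k \<theta>)"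
    unfolding weak_solution_def wp by blast
  ultimately show ?thesis
    by (simp add: weak_laplacian_mode symbol_def algebra_simps power2_eq_square)
qed

text \<open>The hypothesis says that \<open>\<phi>\<close> is an eigenvector of the adjoint of \<open>T\<close>. Hence \<open>\<phi>\<close> is
  orthogonal to every member \<open>e n\<close> of the given eigenbasis whose eigenvalue differs from \<open>c\<close>,
  and when the expansion of \<open>R f\<close> is paired with \<open>\<phi>\<close> only the factors \<open>c powr s\<close> remain. So the
  action of \<open>R\<close> in the direction \<open>\<phi>\<close> can be read off from any eigenbasis.\<close>

lemma fractional_power_eigenvector:
  fixes T R :: "'a::real_inner \<Rightarrow> 'a"
  assumes R: "fractional_power T s R" and eigen: "\<And>f. inner (T f) \<phi> = c * inner f \<phi>"
  shows "inner (R f) \<phi> = c powr s * inner f \<phi>"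
proof -
  obtain e :: "nat \<Rightarrow> 'a" and \<kappa> where
    complete: "\<And>f. (\<lambda>n. inner f (e n) *\<^sub>R e n) sums f" and
    T: "\<And>n. T (e n) = \<kappa> n *\<^sub>R e n" and
    R': "\<And>f. (\<lambda>n. (\<kappa> n powr s * inner f (e n)) *\<^sub>R e n) sums R f"
    using R unfolding fractional_power_def by blast
  have A: "(\<lambda>n. inner ((\<kappa> n powr s * inner f (e n)) *\<^sub>R e n) \<phi>) sums inner (R f) \<phi>"
    using bounded_linear.sums[OF bounded_linear_inner_left R'] .
  have B: "inner ((\<kappa> n powr s * inner f (e n)) *\<^sub>R e n) \<phi> = c powr s * inner (inner f (e n) *\<^sub>R e n) \<phi>" for n
  proof (cases "inner (e n) \<phi> = 0")
    case False
    then have "\<kappa> n = c" using eigen[of "e n"] T[of n] by simp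
    then show ?thesis by simp
  qed simp
  have "(\<lambda>n. c powr s * inner (inner f (e n) *\<^sub>R e n) \<phi>) sums (c powr s * inner f \<phi>)"
    by (intro sums_mult bounded_linear.sums[OF bounded_linear_inner_left] complete)
  with A show ?thesis unfolding B by (rule sums_unique2)
qed

lemma inner_covariance_mode:
  assumes C: "solution_operator \<delta> \<epsilon> q \<tau> a1 a2 a3 C" and Q: "fractional_power C s Q"
    and pos: "0 < symbol \<delta> \<epsilon> q \<tau> a1 a2 a3 k"
  shows "inner (Q f) (mode k \<theta>) = symbol \<delta> \<epsilon> q \<tau> a1 a2 a3 k powr (- s) * inner f (mode k \<theta>)"
proof -
  let ?S = "symbol \<delta> \<epsilon> q \<tau> a1 a2 a3 k"
  have "inner (C f) (mode k \<theta>) = inverse ?S * inner f (mode k \<theta>)" for f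
    using inner_weak_solution_mode[of \<delta> \<epsilon> q \<tau> a1 a2 a3 f "C f" k \<theta>] C pos
    by (simp add: solution_operator_def field_simps)
  from fractional_power_eigenvector[OF Q this] show ?thesis
    using pos by (simp add: powr_minus_divide inverse_eq_divide powr_divide)
qed

section \<open>Partial Fourier sums\<close>

definition frequency_box :: "nat \<Rightarrow> ('d::finite \<Rightarrow> int) set" where
  "frequency_box N = {k. \<forall>i. \<bar>k i\<bar> \<le> int N}"

lemma frequency_box_PiE: "frequency_box N = PiE UNIV (\<lambda>_. {- int N..int N})"
proof -
  have "\<bar>a\<bar> \<le> int N \<longleftrightarrow> a \<in> {- int N..int N}" for a
    by auto
  then show ?thesis
    by (simp add: frequency_box_def PiE_def Pi_def extensional_def)
qed

lemma finite_frequency_box [simp]: "finite (frequency_box N)"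
  unfolding frequency_box_PiE by (intro finite_PiE) auto

lemma uminus_in_frequency_box: "k \<in> frequency_box N \<Longrightarrow> (\<lambda>i. - k i) \<in> frequency_box N"
  by (simp add: frequency_box_def)

lemma zero_in_frequency_box: "(\<lambda>_. 0) \<in> frequency_box N"
  by (simp add: frequency_box_def)

lemma frequency_box_mono: "M \<le> N \<Longrightarrow> frequency_box M \<subseteq> frequency_box N"
  unfolding frequency_box_def using of_nat_mono[of M N] by (auto intro: order_trans)

lemma in_some_frequency_box: "\<exists>N. k \<in> frequency_box N"
proof -
  have "\<bar>k i\<bar> \<le> int (nat (\<Sum>i\<in>UNIV. \<bar>k i\<bar>))" for i
    using member_le_sum[of i UNIV "\<lambda>i. \<bar>k i\<bar>"] by (simp add: sum_nonneg)
  then show ?thesis unfolding frequency_box_def by blast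
qed

text \<open>As a function of \<open>y\<close> this is the Dirichlet kernel, the sum of
  \<open>cos (2 \<pi> k \<cdot> (y - x))\<close> over the box of frequencies. Values and derivatives of partial Fourier sums
  at \<open>x\<close> are inner products with such elements of \<open>L\<^sup>2\<close>, so the Gaussian law of a sample
  determines their joint law.\<close>

definition kernel :: "nat \<Rightarrow> real ^ 'd::finite \<Rightarrow> 'd l2" where
  "kernel N x = (\<Sum>k\<in>frequency_box N. mode k (- phase k x))"

definition kernel_partial :: "nat \<Rightarrow> 'd::finite \<Rightarrow> real ^ 'd \<Rightarrow> 'd l2" where
  "kernel_partial N i x =
    (\<Sum>k\<in>frequency_box N. (2 * pi * of_int (k i)) *\<^sub>R mode k (- phase k x - pi / 2))"

text \<open>Only \<open>l = k\<close> and \<open>l = - k\<close> contribute.\<close>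

lemma sum_frequency_box_inner_mode:
  assumes k: "k \<in> frequency_box N"
  shows "(\<Sum>l\<in>frequency_box N. c l * inner (mode l (\<theta> l)) (mode k \<eta>)) =
    (c (\<lambda>i. - k i) * cos (\<theta> (\<lambda>i. - k i) + \<eta>) + c k * cos (\<theta> k - \<eta>)) / 2"
proof -
  have "(\<Sum>l\<in>frequency_box N. c l * inner (mode l (\<theta> l)) (mode k \<eta>)) =
    ((\<Sum>l\<in>frequency_box N. if l = (\<lambda>i. - k i) then c l * cos (\<theta> l + \<eta>) else 0) +
     (\<Sum>l\<in>frequency_box N. if l = k then c l * cos (\<theta> l - \<eta>) else 0)) / 2"
    unfolding inner_mode sum.distrib[symmetric] sum_divide_distrib
    by (intro sum.cong) (auto simp: distrib_left add_divide_distrib)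
  then show ?thesis
    using k uminus_in_frequency_box[OF k] by (simp add: sum.delta)
qed

lemma inner_kernel_mode:
  assumes "k \<in> frequency_box N"
  shows "inner (kernel N x) (mode k \<theta>) = wave k \<theta> x"
  using sum_frequency_box_inner_mode[OF assms, of "\<lambda>_. 1" "\<lambda>k. - phase k x" \<theta>] cos_minus[of "phase k x + \<theta>"]
  by (simp add: kernel_def inner_sum_left phase_uminus wave_def)

lemma inner_kernel_partial_mode:
  assumes "k \<in> frequency_box N"
  shows "inner (kernel_partial N i x) (mode k \<theta>) = 2 * pi * of_int (k i) * wave k (\<theta> + pi / 2) x"
proof -
  have "cos (- (- phase k x) - pi / 2 + \<theta>) = - wave k (\<theta> + pi / 2) x"
    "cos (- phase k x - pi / 2 - \<theta>) = wave k (\<theta> + pi / 2) x"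
    by (simp_all add: wave_def cos_add cos_diff sin_add sin_diff)
  then show ?thesis
    using sum_frequency_box_inner_mode[OF assms, of "\<lambda>k. 2 * pi * of_int (k i)" "\<lambda>k. - phase k x - pi / 2" \<theta>]
    by (simp add: kernel_partial_def inner_sum_left phase_uminus)
qed

text \<open>The mixed term \<open>s t\<close> is absent: value and derivative of a stationary field at the same
  point are uncorrelated. The reason is that differentiation shifts the phase of each mode in the
  kernel by \<open>\<pi>/2\<close>, and cosine and sine of the same frequency are orthogonal.\<close>

lemma covariance_kernel:
  fixes N :: nat and i :: "'d::finite" and x :: "real ^ 'd"
  assumes Q: "\<And>f k \<theta>. inner (Q f) (mode k \<theta>) = \<mu> k * inner f (mode k \<theta>)"
  defines "h \<equiv> \<lambda>s t. s *\<^sub>R kernel N x + t *\<^sub>R kernel_partial N i x"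
  shows "inner (Q (h s t)) (h s t) =
    s\<^sup>2 * (\<Sum>k\<in>frequency_box N. \<mu> k) + t\<^sup>2 * (\<Sum>k\<in>frequency_box N. \<mu> k * (2 * pi * of_int (k i))\<^sup>2)"
proof -
  have h: "inner (h s t) (mode k \<theta>) = s * wave k \<theta> x + t * (2 * pi * of_int (k i) * wave k (\<theta> + pi / 2) x)"
    if "k \<in> frequency_box N" for k \<theta>
    using that by (simp add: h_def inner_add_left inner_kernel_mode inner_kernel_partial_mode)
  have "inner f (h s t) = (\<Sum>k\<in>frequency_box N. s * inner f (mode k (- phase k x)))
    + (\<Sum>k\<in>frequency_box N. t * (2 * pi * of_int (k i)) * inner f (mode k (- phase k x - pi / 2)))" for f
    unfolding h_def inner_add_right inner_scaleR_right
    by (simp only: kernel_def[of N x] kernel_partial_def[of N i x] inner_sum_right inner_scaleR_right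
        sum_distrib_left mult.assoc)
  then have "inner (Q (h s t)) (h s t) = (\<Sum>k\<in>frequency_box N. s * inner (Q (h s t)) (mode k (- phase k x)))
    + (\<Sum>k\<in>frequency_box N. t * (2 * pi * of_int (k i)) * inner (Q (h s t)) (mode k (- phase k x - pi / 2)))" .
  also have "(\<Sum>k\<in>frequency_box N. s * inner (Q (h s t)) (mode k (- phase k x))) =
    (\<Sum>k\<in>frequency_box N. s\<^sup>2 * \<mu> k)"
    by (intro sum.cong) (simp_all add: Q h wave_def power2_eq_square)
  also have "(\<Sum>k\<in>frequency_box N. t * (2 * pi * of_int (k i)) * inner (Q (h s t)) (mode k (- phase k x - pi / 2))) =
    (\<Sum>k\<in>frequency_box N. t\<^sup>2 * (\<mu> k * (2 * pi * of_int (k i))\<^sup>2))"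
    by (intro sum.cong) (simp_all add: Q h wave_def power2_eq_square)
  finally show ?thesis by (simp only: sum_distrib_left)
qed

definition fourier_sum :: "nat \<Rightarrow> 'd::finite l2 \<Rightarrow> real ^ 'd \<Rightarrow> real" where
  "fourier_sum N v x = inner v (kernel N x)"

definition fourier_sum_partial :: "nat \<Rightarrow> 'd::finite \<Rightarrow> 'd l2 \<Rightarrow> real ^ 'd \<Rightarrow> real" where
  "fourier_sum_partial N i v x = inner v (kernel_partial N i x)"

lemma fourier_sum_eq:
  "fourier_sum N v x = (\<Sum>k\<in>frequency_box N.
     inner v (mode k 0) * wave k 0 x + inner v (mode k (pi / 2)) * wave k (pi / 2) x)"
proof -
  have "wave k (pi / 2) x = - sin (phase k x)" for k
    by (simp add: wave_def minus_sin_cos_eq)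
  then have "inner v (mode k (- phase k x)) =
    inner v (mode k 0) * wave k 0 x + inner v (mode k (pi / 2)) * wave k (pi / 2) x" for k
    by (subst mode_shift) (simp add: inner_diff_right wave_def)
  then show ?thesis by (simp add: fourier_sum_def kernel_def inner_sum_right)
qed

lemma fourier_sum_partial_eq:
  "fourier_sum_partial N i v x = (\<Sum>k\<in>frequency_box N.
     inner v (mode k 0) * (2 * pi * of_int (k i) * wave k (0 + pi / 2) x) +
     inner v (mode k (pi / 2)) * (2 * pi * of_int (k i) * wave k (pi / 2 + pi / 2) x))"
proof -
  have "cos (- phase k x - pi / 2) = wave k (0 + pi / 2) x"
    "sin (- phase k x - pi / 2) = wave k (pi / 2 + pi / 2) x" for k
    using cos_minus[of "phase k x + pi / 2"] sin_minus[of "phase k x + pi / 2"] sin_cos_eq[of "phase k x + pi / 2"]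
    by (simp_all add: wave_def algebra_simps sin_add)
  then have "inner v (mode k (- phase k x - pi / 2)) =
    inner v (mode k 0) * wave k (0 + pi / 2) x + inner v (mode k (pi / 2)) * wave k (pi / 2 + pi / 2) x" for k
    by (subst mode_shift) (simp only: inner_add_right inner_scaleR_right mult.commute)
  then show ?thesis
    by (simp add: fourier_sum_partial_def kernel_partial_def inner_sum_right algebra_simps)
qed

lemma continuous_fourier_sum: "continuous_on UNIV (fourier_sum N v)"
  unfolding fourier_sum_eq[abs_def] by (intro continuous_intros continuous_wave)

lemma continuous_fourier_sum_partial: "continuous_on UNIV (fourier_sum_partial N i v)"
  unfolding fourier_sum_partial_eq[abs_def] by (intro continuous_intros continuous_wave)

lemma fourier_sum_line_derivative:
  "((\<lambda>t. fourier_sum N v (x + t *\<^sub>R axis i 1)) has_real_derivative fourier_sum_partial N i v x) (at 0)"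
  unfolding fourier_sum_eq fourier_sum_partial_eq
  by (intro DERIV_sum DERIV_add DERIV_cmult wave_line_derivative)

lemma mode_uminus: "mode (\<lambda>i. - k i) \<theta> = mode k (- \<theta>)"
proof -
  have "wave (\<lambda>i. - k i) \<theta> = wave k (- \<theta>)"
  proof
    show "wave (\<lambda>i. - k i) \<theta> x = wave k (- \<theta>) x" for x
      using cos_minus[of "phase k x - \<theta>"] by (simp add: wave_def phase_uminus)
  qed
  then show ?thesis by (simp add: mode_def)
qed

lemma l2_class_fourier_sum:
  "l2_class (fourier_sum N v) = (\<Sum>k\<in>frequency_box N.
     inner v (mode k 0) *\<^sub>R mode k 0 + inner v (mode k (pi / 2)) *\<^sub>R mode k (pi / 2))"
proof -
  let ?f = "\<lambda>k x. inner v (mode k 0) * wave k 0 x + inner v (mode k (pi / 2)) * wave k (pi / 2) x"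
  have sq: "square_integrable (?f k)" for k
    by (intro square_integrable_add square_integrable_scale square_integrable_wave)
  have "l2_class (fourier_sum N v) = (\<Sum>k\<in>frequency_box N. l2_class (?f k))"
    unfolding fourier_sum_eq[abs_def] by (rule l2_class_sum[THEN conjunct2]) (use sq in auto)
  also have "\<dots> = (\<Sum>k\<in>frequency_box N.
     inner v (mode k 0) *\<^sub>R mode k 0 + inner v (mode k (pi / 2)) *\<^sub>R mode k (pi / 2))"
    unfolding mode_def
    by (simp add: l2_class_add l2_class_scale square_integrable_scale square_integrable_wave)
  finally show ?thesis .
qed

lemma inner_fourier_sum_mode:
  assumes k: "k \<in> frequency_box N"
  shows "inner (l2_class (fourier_sum N v)) (mode k \<theta>) = inner v (mode k \<theta>)"
proof -
  let ?a = "\<lambda>k. inner v (mode k 0)" and ?b = "\<lambda>k. inner v (mode k (pi / 2))"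
  have "mode k (- (pi / 2)) = - mode k (pi / 2)"
    using mode_pi[of k "- (pi / 2)"] by simp
  then have sym: "?a (\<lambda>i. - k i) = ?a k" "?b (\<lambda>i. - k i) = - ?b k"
    by (simp_all add: mode_uminus)
  have "inner (l2_class (fourier_sum N v)) (mode k \<theta>) =
    (\<Sum>l\<in>frequency_box N. ?a l * inner (mode l 0) (mode k \<theta>)) +
    (\<Sum>l\<in>frequency_box N. ?b l * inner (mode l (pi / 2)) (mode k \<theta>))"
    by (simp add: l2_class_fourier_sum inner_sum_left inner_add_left sum.distrib)
  also have "\<dots> = (?a k * cos \<theta> + ?a k * cos \<theta>) / 2 + (- ?b k * cos (pi / 2 + \<theta>) + ?b k * cos (pi / 2 - \<theta>)) / 2"
    using sum_frequency_box_inner_mode[OF k, of ?a "\<lambda>_. 0" \<theta>]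
      sum_frequency_box_inner_mode[OF k, of ?b "\<lambda>_. pi / 2" \<theta>]
    by (simp add: sym)
  also have "\<dots> = cos \<theta> * ?a k + sin \<theta> * ?b k"
    by (simp add: cos_add cos_diff)
  also have "\<dots> = inner v (mode k \<theta>)"
    by (subst (3) mode_shift) (simp add: inner_add_right)
  finally show ?thesis .
qed

text \<open>Partial Fourier sums are orthogonal projections onto the span of the modes in a box, hence
  best approximations; every element of the dense span of all modes lies in the span of some box.\<close>

lemma fourier_sum_tendsto:
  fixes v :: "'d::finite l2"
  shows "(\<lambda>N. l2_class (fourier_sum N v)) \<longlonglongrightarrow> v"
proof (rule LIMSEQ_I)
  fix e :: real assume "0 < e"
  define S where "S N = span ((\<lambda>(k, \<theta>). mode k \<theta>) ` ((frequency_box N :: ('d \<Rightarrow> int) set) \<times> (UNIV :: real set)))"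
    for N :: nat
  have S_mono: "S M \<subseteq> S N" if "M \<le> N" for M N :: nat
    unfolding S_def by (intro span_mono image_mono Sigma_mono frequency_box_mono that) auto
  have "subspace (\<Union>N. S N)"
    unfolding subspace_def
  proof safe
    show "0 \<in> (\<Union>N. S N)" by (auto simp: S_def intro: span_zero)
    show "x + y \<in> (\<Union>N. S N)" if "x \<in> S M" "y \<in> S N" for x y M N
    proof -
      have "x \<in> S (max M N)" "y \<in> S (max M N)"
        using that S_mono[of M "max M N"] S_mono[of N "max M N"] by auto
      then have "x + y \<in> S (max M N)" by (simp add: S_def span_add)
      then show ?thesis by blast
    qed
    show "c *\<^sub>R x \<in> (\<Union>N. S N)" if "x \<in> S N" for c x N
      using that unfolding S_def by (blast intro: span_scale)
  qed
  moreover have "mode k \<theta> \<in> (\<Union>N. S N)" for k :: "'d \<Rightarrow> int" and \<theta>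
  proof -
    obtain N where "k \<in> frequency_box N" using in_some_frequency_box by blast
    then have "mode k \<theta> \<in> S N" unfolding S_def by (intro span_base) force
    then show ?thesis by auto
  qed
  then have "range (case_prod mode) \<subseteq> (\<Union>N. S N)" by auto
  ultimately have "span (range (case_prod mode)) \<subseteq> (\<Union>N. S N)"
    by (intro span_minimal)
  moreover have "v \<in> closure (span (range (case_prod mode)))"
    unfolding closure_span_modes by simp
  ultimately obtain M g where g: "g \<in> S M" "dist g v < e"
    using \<open>0 < e\<close> unfolding closure_approachable by blast
  show "\<exists>no. \<forall>N\<ge>no. norm (l2_class (fourier_sum N v) - v) < e"
  proof (intro exI allI impI)
    fix N assume "M \<le> N"
    define p where "p = l2_class (fourier_sum N v)"
    let ?O = "{u. inner (p - v) u = 0}"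
    have "S N \<subseteq> ?O"
      unfolding S_def
      by (intro span_minimal) (auto simp: subspace_def inner_add_right inner_diff_left p_def inner_fourier_sum_mode)
    moreover have "p \<in> S N"
    proof -
      have "mode k \<theta> \<in> S N" if "k \<in> frequency_box N" for k \<theta>
        unfolding S_def using that by (intro span_base) force
      then show ?thesis
        unfolding p_def l2_class_fourier_sum S_def
        by (intro span_sum span_add span_scale) auto
    qed
    moreover have "g \<in> S N" using g(1) S_mono[OF \<open>M \<le> N\<close>] by blast
    ultimately have "inner (p - v) p = 0" "inner (p - v) g = 0" by auto
    then have orth: "inner (p - v) (g - p) = 0" by (simp add: inner_diff_right)
    then have "(norm ((p - v) + (g - p)))\<^sup>2 = (norm (p - v))\<^sup>2 + (norm (g - p))\<^sup>2"
      by (intro norm_add_Pythagorean) (simp add: orthogonal_def)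
    then have "(norm (p - v))\<^sup>2 \<le> (norm (g - v))\<^sup>2" by simp
    then have "norm (p - v) \<le> norm (g - v)"
      by (simp add: power2_le_iff_abs_le)
    then show "norm (l2_class (fourier_sum N v) - v) < e"
      using g(2) by (simp add: p_def dist_norm)
  qed
qed

section \<open>Gaussian random variables\<close>

lemma integral_normal_law: "0 \<le> \<sigma> \<Longrightarrow> (\<integral>x. x \<partial>normal_law c \<sigma>) = c"
  by (auto simp: normal_law_def integral_return integral_density integral_normal_moment_nz_1)

lemma variance_normal_law: "0 \<le> \<sigma> \<Longrightarrow> (\<integral>x. x\<^sup>2 \<partial>normal_law 0 \<sigma>) = \<sigma>\<^sup>2"
  using integral_normal_moment_even[of \<sigma> 0 1]
  by (auto simp: normal_law_def integral_return integral_density)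

text \<open>The case of positive variance is reduced to the standard normal law by scaling.\<close>

lemma char_normal_law:
  assumes "0 \<le> \<sigma>"
  shows "char (normal_law 0 \<sigma>) t = exp (- (t\<^sup>2 * \<sigma>\<^sup>2) / 2)"
proof (cases "\<sigma> = 0")
  case True
  then show ?thesis by (simp add: char_def normal_law_def integral_return)
next
  case False
  with assms have "0 < \<sigma>" by simp
  define M where "M = density lborel (normal_density 0 \<sigma>)"
  interpret prob_space M
    unfolding M_def by (rule prob_space_normal_density) fact
  have "distributed M lborel (\<lambda>x. x) (normal_density 0 \<sigma>)"
    by (auto simp: distributed_def M_def intro!: distr_id2)
  then have "distributed M lborel (\<lambda>x. x / \<sigma>) std_normal_density"
    by (subst (asm) normal_standard_normal_convert[OF \<open>0 < \<sigma>\<close>]) simp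
  then have D: "distr M lborel (\<lambda>x. x / \<sigma>) = std_normal_distribution"
    by (simp add: distributed_def)
  have "char M t = (CLINT x|M. iexp (t * \<sigma> * (x / \<sigma>)))"
    using False by (simp add: char_def)
  also have "\<dots> = (CLINT x|distr M lborel (\<lambda>x. x / \<sigma>). iexp (t * \<sigma> * x))"
    by (rule integral_distr[symmetric]) (auto simp: M_def)
  also have "\<dots> = char std_normal_distribution (t * \<sigma>)"
    unfolding D char_def ..
  finally show ?thesis
    using False by (simp add: char_std_normal_distribution normal_law_def M_def power_mult_distrib)
qed

lemma gaussian_measure_marginal:
  assumes G: "gaussian_measure \<mu> 0 Q"
  shows "0 \<le> inner (Q h) h"
    and "distr \<mu> borel (\<lambda>x. inner x h) = normal_law 0 (sqrt (inner (Q h) h))"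
proof -
  have sets: "sets \<mu> = sets borel" using G by (simp add: gaussian_measure_def)
  have [measurable]: "(\<lambda>x. inner x h) \<in> borel_measurable \<mu>"
    unfolding measurable_cong_sets[OF sets refl]
    by (intro borel_measurable_continuous_onI continuous_intros)
  obtain c \<sigma> where \<sigma>: "0 \<le> \<sigma>" and D: "distr \<mu> borel (\<lambda>x. inner x h) = normal_law c \<sigma>"
    using G unfolding gaussian_measure_def by blast
  have "c = (\<integral>x. x \<partial>distr \<mu> borel (\<lambda>x. inner x h))"
    unfolding D using \<sigma> by (simp add: integral_normal_law)
  also have "\<dots> = (\<integral>x. inner x h \<partial>\<mu>)"
    by (rule integral_distr) auto
  also have "\<dots> = 0" using G by (simp add: gaussian_measure_def)
  finally have c: "c = 0" .
  have "\<sigma>\<^sup>2 = (\<integral>x. x\<^sup>2 \<partial>distr \<mu> borel (\<lambda>x. inner x h))"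
    unfolding D c using \<sigma> by (simp add: variance_normal_law)
  also have "\<dots> = (\<integral>x. (inner x h)\<^sup>2 \<partial>\<mu>)"
    by (rule integral_distr) auto
  also have "\<dots> = inner (Q h) h" using G by (simp add: gaussian_measure_def power2_eq_square)
  finally have s: "\<sigma>\<^sup>2 = inner (Q h) h" .
  then show "0 \<le> inner (Q h) h" by (metis zero_le_power2)
  show "distr \<mu> borel (\<lambda>x. inner x h) = normal_law 0 (sqrt (inner (Q h) h))"
    unfolding D c s[symmetric] using \<sigma> by simp
qed

lemma second_order_cosine_limit:
  fixes y :: real
  shows "(\<lambda>n. 2 * (1 - cos (inverse (real (Suc n)) * y)) / (inverse (real (Suc n)))\<^sup>2) \<longlonglongrightarrow> y\<^sup>2"
proof (cases "y = 0")
  case False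
  \<comment> \<open>\<open>1 - cos (2 t) = 2 (sin t)\<^sup>2\<close> reduces the claim to the limit of \<open>sin t / t\<close>.\<close>
  define t where "t n = inverse (real (Suc n)) * y / 2" for n
  have "t \<longlonglongrightarrow> 0 * y / 2"
    unfolding t_def by (intro tendsto_intros LIMSEQ_inverse_real_of_nat) simp
  moreover have "t n \<noteq> 0" for n using False by (simp add: t_def)
  ultimately have "filterlim t (at 0) sequentially"
    by (simp add: filterlim_at)
  moreover have "((\<lambda>x::real. sin x / x) \<longlongrightarrow> 1) (at 0)"
    using DERIV_sin[of "0::real"] by (simp add: DERIV_def)
  ultimately have "(\<lambda>n. sin (t n) / t n) \<longlonglongrightarrow> 1"
    by (rule filterlim_compose[rotated])
  then have "(\<lambda>n. y\<^sup>2 * (sin (t n) / t n)\<^sup>2) \<longlonglongrightarrow> y\<^sup>2 * 1\<^sup>2"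
    by (intro tendsto_intros)
  moreover have "y\<^sup>2 * (sin (t n) / t n)\<^sup>2 = 2 * (1 - cos (inverse (real (Suc n)) * y)) / (inverse (real (Suc n)))\<^sup>2" for n
  proof -
    define m where "m = inverse (real (Suc n))"
    have "m \<noteq> 0" by (simp add: m_def)
    have tn: "t n = m * y / 2" by (simp only: t_def m_def)
    have "2 * (1 - cos (m * y)) = 4 * (sin (t n))\<^sup>2"
      using cos_double_sin[of "t n"] by (simp add: tn)
    moreover have "y\<^sup>2 * (sin (t n) / t n)\<^sup>2 = 4 * (sin (t n))\<^sup>2 / m\<^sup>2"
      using False \<open>m \<noteq> 0\<close> by (simp add: tn power_divide power_mult_distrib)
    ultimately show ?thesis by (simp only: m_def)
  qed
  ultimately show ?thesis by simp
qed simp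

text \<open>The assumption on the characteristic function expresses that \<open>U\<close> and \<open>Y\<close> are jointly
  Gaussian, centred and uncorrelated, with variances \<open>a\<close> and \<open>b\<close>. The
  independence behind this inequality comes from one-dimensional characteristic functions: under the
  probability measure with density proportional to \<open>2 - cos (t Y)\<close> the variable \<open>U\<close> has the same
  characteristic function, hence the same law, as before. This factorises the expectation of
  \<open>g(U) (1 - cos (t Y))\<close>. Dividing by \<open>t\<^sup>2/2\<close> and letting \<open>t\<close> tend to 0 gives the claim by
  Fatou's lemma. The summand 2 keeps the density positive even when \<open>Y\<close> is degenerate.\<close>

lemma (in prob_space) uncorrelated_gaussian_moment:
  fixes U Y :: "'a \<Rightarrow> real" and g :: "real \<Rightarrow> real"
  assumes [measurable]: "U \<in> borel_measurable M" "Y \<in> borel_measurable M" "g \<in> borel_measurable borel"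
    and char: "\<And>s t. (CLINT x|M. iexp (s * U x + t * Y x)) = exp (- (s\<^sup>2 * a + t\<^sup>2 * b) / 2)"
    and b: "0 \<le> b" and g: "\<And>u. 0 \<le> g u" "\<And>u. g u \<le> B"
  shows "(\<integral>\<^sup>+x. ennreal (g (U x) * (Y x)\<^sup>2) \<partial>M) \<le> ennreal (b * expectation (\<lambda>x. g (U x)))"
proof -
  have gB: "\<bar>g u\<bar> \<le> B" for u using g[of u] by simp
  have cos2: "\<bar>1 - cos u\<bar> \<le> 2" "\<bar>2 - cos u\<bar> \<le> 3" "0 \<le> 2 - cos u" for u :: real
    using cos_ge_minus_one[of u] cos_le_one[of u] by linarith+
  have int_iexp: "integrable M (\<lambda>x. iexp (f x))" if "f \<in> borel_measurable M" for f
    using that by (intro integrable_const_bound[where B=1]) auto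
  have tilt: "expectation (\<lambda>x. g (U x) * (1 - cos (t * Y x))) = (1 - exp (- (t\<^sup>2 * b) / 2)) * expectation (\<lambda>x. g (U x))" for t
  proof -
    define r where "r = exp (- (t\<^sup>2 * b) / 2)"
    define f where "f x = (2 - cos (t * Y x)) / (2 - r)" for x
    have "r \<le> 1" using b by (simp add: r_def)
    then have r: "0 < 2 - r" by simp
    have fpos: "0 \<le> f x" for x
      unfolding f_def using r cos2(3) by (intro divide_nonneg_pos)
    have [measurable]: "f \<in> borel_measurable M" unfolding f_def by measurable
    have U: "(CLINT x|M. iexp (s * U x)) = exp (- (s\<^sup>2 * a) / 2)" for s
      using char[of s 0] by simp
    have cosint: "(CLINT x|M. cos (t * Y x) * iexp (s * U x)) = r * exp (- (s\<^sup>2 * a) / 2)" for s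
    proof -
      have "(CLINT x|M. cos (t * Y x) * iexp (s * U x)) =
        (CLINT x|M. (iexp (s * U x + t * Y x) + iexp (s * U x + (- t) * Y x)) / 2)"
      proof (intro Bochner_Integration.integral_cong refl)
        fix x
        have "complex_of_real (cos (t * Y x)) = (iexp (t * Y x) + iexp ((- t) * Y x)) / 2"
          by (simp add: cos_of_real[symmetric] cos_exp_eq)
        moreover have "iexp (s * U x + t * Y x) = iexp (s * U x) * iexp (t * Y x)"
          "iexp (s * U x + (- t) * Y x) = iexp (s * U x) * iexp ((- t) * Y x)"
          by (simp_all only: of_real_add distrib_left exp_add)
        ultimately show "complex_of_real (cos (t * Y x)) * iexp (s * U x) =
            (iexp (s * U x + t * Y x) + iexp (s * U x + (- t) * Y x)) / 2"
          by (simp only: distrib_left[symmetric] times_divide_eq_right mult.commute)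
      qed
      also have "\<dots> = ((CLINT x|M. iexp (s * U x + t * Y x)) + (CLINT x|M. iexp (s * U x + (- t) * Y x))) / 2"
      proof -
        have "integrable M (\<lambda>x. iexp (s * U x + t * Y x))" "integrable M (\<lambda>x. iexp (s * U x + (- t) * Y x))"
          by (rule int_iexp, measurable)+
        then show ?thesis
          by (simp only: integral_divide_zero Bochner_Integration.integral_add)
      qed
      also have "\<dots> = exp (- (s\<^sup>2 * a + t\<^sup>2 * b) / 2)"
        unfolding char by simp
      also have "- (s\<^sup>2 * a + t\<^sup>2 * b) / 2 = - (t\<^sup>2 * b) / 2 + - (s\<^sup>2 * a) / 2" by simp
      finally show ?thesis unfolding exp_add r_def by simp
    qed
    have fU: "(CLINT x|M. f x *\<^sub>R iexp (s * U x)) = exp (- (s\<^sup>2 * a) / 2)" for s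
    proof -
      have "(CLINT x|M. f x *\<^sub>R iexp (s * U x)) =
        (CLINT x|M. (2 * iexp (s * U x) - cos (t * Y x) * iexp (s * U x)) / complex_of_real (2 - r))"
        by (intro Bochner_Integration.integral_cong refl)
           (simp add: f_def scaleR_conv_of_real left_diff_distrib diff_divide_distrib)
      also have "\<dots> = (2 * (CLINT x|M. iexp (s * U x)) - (CLINT x|M. cos (t * Y x) * iexp (s * U x))) / complex_of_real (2 - r)"
      proof (subst integral_divide_zero, subst Bochner_Integration.integral_diff)
        show "integrable M (\<lambda>x. complex_of_real (cos (t * Y x)) * iexp (s * U x))"
          by (intro integrable_const_bound[where B=1]) (auto simp: norm_mult)
        show "integrable M (\<lambda>x. 2 * iexp (s * U x))"
          by (intro integrable_mult_right int_iexp) measurable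
      qed simp
      also have "\<dots> = complex_of_real ((2 * exp (- (s\<^sup>2 * a) / 2) - r * exp (- (s\<^sup>2 * a) / 2)) / (2 - r))"
        unfolding U cosint by simp
      also have "(2 * exp (- (s\<^sup>2 * a) / 2) - r * exp (- (s\<^sup>2 * a) / 2)) / (2 - r) = exp (- (s\<^sup>2 * a) / 2)"
        using r by (simp add: left_diff_distrib[symmetric])
      finally show ?thesis .
    qed
    have int_f: "integrable M f"
    proof (intro integrable_const_bound[where B="3 / (2 - r)"] AE_I2)
      show "norm (f x) \<le> 3 / (2 - r)" for x
        using r cos2(2)[of "t * Y x"] unfolding f_def real_norm_def abs_divide
        by (intro frac_le) auto
    qed measurable
    have Ef: "expectation f = 1"
    proof -
      have "complex_of_real (expectation f) = (CLINT x|M. f x *\<^sub>R iexp (0 * U x))"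
        by (simp add: scaleR_conv_of_real)
      also have "\<dots> = 1" unfolding fU by simp
      finally show ?thesis by simp
    qed
    define N where "N = density M (\<lambda>x. ennreal (f x))"
    have "emeasure N (space N) = (\<integral>\<^sup>+x. ennreal (f x) \<partial>M)"
      unfolding N_def by (subst emeasure_density) (auto intro!: nn_integral_cong)
    also have "\<dots> = 1"
      using int_f Ef fpos by (subst nn_integral_eq_integral) auto
    finally have "prob_space N" by (rule prob_spaceI)
    interpret N: prob_space N by fact
    have UN: "U \<in> borel_measurable N" by (simp add: N_def)
    have "distr N borel U = distr M borel U"
    proof (rule Levy_uniqueness)
      show "real_distribution (distr N borel U)" using UN by simp
      show "real_distribution (distr M borel U)" by simp
      show "char (distr N borel U) = char (distr M borel U)"
      proof
        fix s
        have "char (distr N borel U) s = (CLINT x|N. iexp (s * U x))"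
          unfolding char_def using UN by (subst integral_distr) auto
        also have "\<dots> = (CLINT x|M. f x *\<^sub>R iexp (s * U x))"
          unfolding N_def using fpos by (subst integral_density) auto
        also have "\<dots> = (CLINT x|M. iexp (s * U x))"
          unfolding fU U ..
        also have "\<dots> = char (distr M borel U) s"
          unfolding char_def by (subst integral_distr) auto
        finally show "char (distr N borel U) s = char (distr M borel U) s" .
      qed
    qed
    then have "integral\<^sup>L (distr N borel U) g = integral\<^sup>L (distr M borel U) g" by simp
    moreover have "integral\<^sup>L (distr N borel U) g = (\<integral>x. g (U x) \<partial>N)"
      using UN by (intro integral_distr) auto
    moreover have "integral\<^sup>L (distr M borel U) g = expectation (\<lambda>x. g (U x))"
      by (intro integral_distr) auto
    moreover have "(\<integral>x. g (U x) \<partial>N) = expectation (\<lambda>x. f x * g (U x))"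
      unfolding N_def using fpos by (subst integral_density) auto
    moreover have "(2 - r) * expectation (\<lambda>x. f x * g (U x)) = expectation (\<lambda>x. (2 - cos (t * Y x)) * g (U x))"
      using r by (subst integral_mult_right_zero[symmetric]) (simp add: f_def)
    moreover have "expectation (\<lambda>x. (2 - cos (t * Y x)) * g (U x)) =
      expectation (\<lambda>x. g (U x)) + expectation (\<lambda>x. g (U x) * (1 - cos (t * Y x)))"
    proof (subst Bochner_Integration.integral_add[symmetric])
      show "integrable M (\<lambda>x. g (U x))"
        using gB by (intro integrable_const_bound[where B=B] AE_I2) auto
      have "norm (g (U x) * (1 - cos (t * Y x))) \<le> B * 2" for x
        unfolding real_norm_def abs_mult by (intro mult_mono gB cos2) (use gB[of 0] in auto)
      then show "integrable M (\<lambda>x. g (U x) * (1 - cos (t * Y x)))"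
        by (intro integrable_const_bound[where B="B * 2"] AE_I2) auto
    qed (simp add: algebra_simps)
    ultimately have "(2 - r) * expectation (\<lambda>x. g (U x)) =
      expectation (\<lambda>x. g (U x)) + expectation (\<lambda>x. g (U x) * (1 - cos (t * Y x)))" by metis
    then show ?thesis by (simp add: r_def algebra_simps)
  qed
  define \<eta> where "\<eta> n = inverse (real (Suc n))" for n
  have \<eta>: "0 < \<eta> n" for n by (simp add: \<eta>_def)
  let ?X = "\<lambda>n x. g (U x) * (2 * (1 - cos (\<eta> n * Y x)) / (\<eta> n)\<^sup>2)"
  have X0: "0 \<le> ?X n x" for n x
    using g(1) by (intro mult_nonneg_nonneg divide_nonneg_nonneg) auto
  have "(\<integral>\<^sup>+x. ennreal (?X n x) \<partial>M) \<le> ennreal (b * expectation (\<lambda>x. g (U x)))" for n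
  proof -
    have E0: "0 \<le> expectation (\<lambda>x. g (U x))" using g by simp
    have "norm (?X n x) \<le> B * (2 * 2 / (\<eta> n)\<^sup>2)" for x
    proof -
      have "\<bar>2 * (1 - cos (\<eta> n * Y x))\<bar> \<le> 2 * 2"
        unfolding abs_mult by (intro mult_mono cos2) auto
      then have "\<bar>2 * (1 - cos (\<eta> n * Y x))\<bar> / (\<eta> n)\<^sup>2 \<le> 2 * 2 / (\<eta> n)\<^sup>2"
        by (intro divide_right_mono) auto
      then have "\<bar>2 * (1 - cos (\<eta> n * Y x)) / (\<eta> n)\<^sup>2\<bar> \<le> 2 * 2 / (\<eta> n)\<^sup>2"
        by (simp only: abs_divide abs_power2)
      then show ?thesis 
        unfolding real_norm_def abs_mult[of "g (U x)"] by (intro mult_mono gB) (use gB[of 0] in auto)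
    qed
    then have "integrable M (?X n)"
      by (intro integrable_const_bound[where B="B * (2 * 2 / (\<eta> n)\<^sup>2)"] AE_I2) auto
    then have "(\<integral>\<^sup>+x. ennreal (?X n x) \<partial>M) = ennreal (expectation (?X n))"
      using X0 by (intro nn_integral_eq_integral) auto
    also have "expectation (?X n) = 2 / (\<eta> n)\<^sup>2 * expectation (\<lambda>x. g (U x) * (1 - cos (\<eta> n * Y x)))"
      by (subst integral_mult_right_zero[symmetric]) (simp add: ac_simps)
    also have "\<dots> = 2 / (\<eta> n)\<^sup>2 * (1 - exp (- ((\<eta> n)\<^sup>2 * b) / 2)) * expectation (\<lambda>x. g (U x))"
      unfolding tilt by simp
    also have "\<dots> \<le> b * expectation (\<lambda>x. g (U x))"
    proof (rule mult_right_mono[OF _ E0])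
      have "1 - exp (- ((\<eta> n)\<^sup>2 * b) / 2) \<le> (\<eta> n)\<^sup>2 * b / 2"
        using exp_ge_add_one_self[of "- ((\<eta> n)\<^sup>2 * b) / 2"] by simp
      then have "2 / (\<eta> n)\<^sup>2 * (1 - exp (- ((\<eta> n)\<^sup>2 * b) / 2)) \<le> 2 / (\<eta> n)\<^sup>2 * ((\<eta> n)\<^sup>2 * b / 2)"
        by (intro mult_left_mono) auto
      also have "\<dots> = b" using \<eta>[of n] by simp
      finally show "2 / (\<eta> n)\<^sup>2 * (1 - exp (- ((\<eta> n)\<^sup>2 * b) / 2)) \<le> b" .
    qed
    finally show ?thesis by (simp add: ennreal_leI)
  qed
  then have "liminf (\<lambda>n. \<integral>\<^sup>+x. ennreal (?X n x) \<partial>M) \<le> ennreal (b * expectation (\<lambda>x. g (U x)))"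
    by (intro Liminf_le) (auto simp: always_eventually)
  moreover have "(\<integral>\<^sup>+x. ennreal (g (U x) * (Y x)\<^sup>2) \<partial>M) \<le> liminf (\<lambda>n. \<integral>\<^sup>+x. ennreal (?X n x) \<partial>M)"
  proof -
    have "(\<lambda>n. ennreal (?X n x)) \<longlonglongrightarrow> ennreal (g (U x) * (Y x)\<^sup>2)" for x
      unfolding \<eta>_def by (intro tendsto_ennrealI tendsto_mult tendsto_const second_order_cosine_limit)
    then have "liminf (\<lambda>n. ennreal (?X n x)) = ennreal (g (U x) * (Y x)\<^sup>2)" for x
      by (intro lim_imp_Liminf) auto
    then have "(\<integral>\<^sup>+x. ennreal (g (U x) * (Y x)\<^sup>2) \<partial>M) = (\<integral>\<^sup>+x. liminf (\<lambda>n. ennreal (?X n x)) \<partial>M)"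
      by simp
    also have "\<dots> \<le> liminf (\<lambda>n. \<integral>\<^sup>+x. ennreal (?X n x) \<partial>M)"
      by (rule nn_integral_liminf) measurable
    finally show ?thesis .
  qed
  ultimately show ?thesis by order
qed

section \<open>A smooth approximation of the threshold\<close>

text \<open>The derivative of \<open>\<lambda>u. arctan (m * u)\<close>, an approximation of \<open>\<pi>\<close> times the Dirac measure.\<close>

definition ramp_slope :: "real \<Rightarrow> real \<Rightarrow> real" where
  "ramp_slope m u = m / (1 + (m * u)\<^sup>2)"

lemma ramp_slope_bounds: "0 < m \<Longrightarrow> 0 \<le> ramp_slope m u" "0 < m \<Longrightarrow> ramp_slope m u \<le> m"
proof -
  show "0 < m \<Longrightarrow> 0 \<le> ramp_slope m u" by (simp add: ramp_slope_def)
  show "0 < m \<Longrightarrow> ramp_slope m u \<le> m"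
    using frac_le[of m m 1 "1 + (m * u)\<^sup>2"] by (simp add: ramp_slope_def)
qed

lemma continuous_ramp_slope: "continuous_on UNIV (ramp_slope m)"
proof -
  have "1 + (m * u)\<^sup>2 \<noteq> 0" for u
    using zero_le_power2[of "m * u"] by linarith
  then show ?thesis
    unfolding ramp_slope_def by (intro continuous_intros) auto
qed

lemma borel_measurable_ramp_slope [measurable]: "ramp_slope m \<in> borel_measurable borel"
  by (rule borel_measurable_continuous_onI) (rule continuous_ramp_slope)

lemma DERIV_ramp: "((\<lambda>u. arctan (m * u)) has_real_derivative ramp_slope m u) (at u)"
  by (auto intro!: derivative_eq_intros simp: ramp_slope_def field_simps)

lemma arctan_mult_lipschitz:
  assumes "0 < m"
  shows "\<bar>arctan (m * a) - arctan (m * b)\<bar> \<le> m * \<bar>a - b\<bar>"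
proof -
  have "norm (arctan (m * a) - arctan (m * b)) \<le> m * norm (a - b)"
    using ramp_slope_bounds[OF assms]
    by (intro field_differentiable_bound[OF convex_UNIV DERIV_ramp]) auto
  then show ?thesis by simp
qed

lemma arctan_mult_tendsto_sgn: "(\<lambda>n. arctan (real (Suc n) * u)) \<longlonglongrightarrow> pi / 2 * sgn u"
proof -
  have lim: "(\<lambda>n. arctan (real (Suc n) * y)) \<longlonglongrightarrow> pi / 2" if "0 < y" for y
  proof (rule filterlim_compose[OF tendsto_arctan_at_top])
    have "filterlim (\<lambda>n. real (Suc n)) at_top sequentially"
      using filterlim_compose[OF filterlim_real_sequentially filterlim_Suc] .
    then show "filterlim (\<lambda>n. real (Suc n) * y) at_top sequentially"
      using filterlim_tendsto_pos_mult_at_top[OF tendsto_const[of y] that] by (simp add: mult.commute)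
  qed
  consider "0 < u" | "u = 0" | "u < 0" by linarith
  then show ?thesis
  proof cases
    case 3
    then have "(\<lambda>n. - arctan (real (Suc n) * (- u))) \<longlonglongrightarrow> - (pi / 2)"
      by (intro tendsto_minus lim) simp
    then show ?thesis using 3 by (simp add: arctan_minus del: of_nat_Suc)
  qed (use lim in auto)
qed

lemma integral_ramp_slope:
  assumes m: "0 < m"
  shows "integrable lborel (ramp_slope m)" "(\<integral>u. ramp_slope m u \<partial>lborel) = pi"
proof -
  let ?f = "\<lambda>x::real. inverse (1 + x\<^sup>2)"
  have f: "integrable lborel ?f" "integral\<^sup>L lborel ?f = pi"
    using integrable_inverse_1_plus_square LBINT_inverse_1_plus_square
    by (simp_all add: interval_lebesgue_integral_def set_integrable_def set_lebesgue_integral_def einterval_def)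
  have eq: "ramp_slope m = (\<lambda>u. m * ?f (0 + m * u))"
    by (simp add: fun_eq_iff ramp_slope_def divide_inverse)
  show "integrable lborel (ramp_slope m)"
    unfolding eq using m f(1) by (intro integrable_mult_right lborel_integrable_real_affine) auto
  show "(\<integral>u. ramp_slope m u \<partial>lborel) = pi"
    unfolding eq using lborel_integral_real_affine[of m ?f 0] m f by simp
qed

text \<open>The density is at most \<open>1 / \<sigma>\<close> and the slope has integral \<open>\<pi>\<close>, so the bound does not
  depend on \<open>m\<close>.\<close>

lemma integral_ramp_slope_normal_law:
  assumes m: "0 < m" and \<sigma>: "0 < \<sigma>"
  shows "(\<integral>u. ramp_slope m u \<partial>normal_law 0 \<sigma>) \<le> pi / \<sigma>"
proof -
  have "(\<integral>u. ramp_slope m u \<partial>normal_law 0 \<sigma>) = (\<integral>u. normal_density 0 \<sigma> u * ramp_slope m u \<partial>lborel)"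
    using \<sigma> by (simp add: normal_law_def integral_density)
  also have "\<dots> \<le> (\<integral>u. 1 / \<sigma> * ramp_slope m u \<partial>lborel)"
  proof (rule integral_mono')
    show "integrable lborel (\<lambda>u. 1 / \<sigma> * ramp_slope m u)"
      by (intro integrable_mult_right integral_ramp_slope m)
    fix u
    have "\<sigma> \<le> sqrt (2 * pi * \<sigma>\<^sup>2)"
      using pi_gt3 \<sigma> by (intro real_le_rsqrt) (simp add: mult_le_cancel_right1)
    then have "1 / sqrt (2 * pi * \<sigma>\<^sup>2) * exp (- (u - 0)\<^sup>2 / (2 * \<sigma>\<^sup>2)) \<le> 1 / \<sigma> * 1"
      using \<sigma> by (intro mult_mono frac_le) auto
    then show "normal_density 0 \<sigma> u * ramp_slope m u \<le> 1 / \<sigma> * ramp_slope m u"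
      using ramp_slope_bounds(1)[OF m] by (intro mult_right_mono) (auto simp: normal_density_def)
    show "0 \<le> 1 / \<sigma> * ramp_slope m u"
      using ramp_slope_bounds(1)[OF m] \<sigma> by simp
  qed
  also have "\<dots> = pi / \<sigma>"
    using integral_ramp_slope[OF m] by simp
  finally show ?thesis .
qed


section \<open>Summability of the spectrum\<close>

text \<open>The box is a product set, so the sum factorises.\<close>

lemma sum_frequency_box_prod:
  fixes w :: "int \<Rightarrow> real"
  shows "(\<Sum>k\<in>(frequency_box N :: ('d::finite \<Rightarrow> int) set). \<Prod>i\<in>UNIV. w (k i)) = (\<Sum>j\<in>{- int N..int N}. w j) ^ CARD('d)"
proof -
  have "(\<Prod>i\<in>(UNIV :: 'd set). \<Sum>j\<in>{- int N..int N}. w j) =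
    (\<Sum>k\<in>(frequency_box N :: ('d \<Rightarrow> int) set). \<Prod>i\<in>UNIV. w (k i))"
    unfolding frequency_box_PiE using prod_sum_PiE[of "UNIV :: 'd set" "\<lambda>_. {- int N..int N}" "\<lambda>_. w"] by simp
  then show ?thesis by simp
qed

lemma sum_int_interval_bounded:
  assumes "1 < \<beta>"
  shows "\<exists>W\<ge>0. \<forall>N. (\<Sum>j\<in>{- int N..int N}. (1 + real_of_int \<bar>j\<bar>) powr - \<beta>) \<le> W"
proof -
  let ?w = "\<lambda>j::int. (1 + real_of_int \<bar>j\<bar>) powr - \<beta>"
  have "summable (\<lambda>n. real (Suc n) powr - \<beta>)"
    using assms summable_Suc_iff[of "\<lambda>n. real n powr - \<beta>"] by (simp add: summable_real_powr_iff del: of_nat_Suc)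
  then have s: "(\<Sum>n\<le>N. real (Suc n) powr - \<beta>) \<le> (\<Sum>n. real (Suc n) powr - \<beta>)" for N
    by (intro sum_le_suminf) auto
  have "(\<Sum>j\<in>{- int N..int N}. ?w j) \<le> 2 * (\<Sum>n. real (Suc n) powr - \<beta>)" for N
  proof -
    have im: "(\<Sum>j\<in>f ` {..N}. ?w j) = (\<Sum>n\<le>N. real (Suc n) powr - \<beta>)" if "\<And>n. \<bar>f n\<bar> = int n" for f
    proof (subst sum.reindex)
      show "inj_on f {..N}" using that by (metis inj_onI of_nat_eq_iff)
      show "sum (?w \<circ> f) {..N} = (\<Sum>n\<le>N. real (Suc n) powr - \<beta>)"
      proof (intro sum.cong)
        fix n
        have "\<bar>real_of_int (f n)\<bar> = real n"
          using that[of n] by (metis of_int_abs of_int_of_nat_eq)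
        then show "(?w \<circ> f) n = real (Suc n) powr - \<beta>" by (simp add: add.commute)
      qed simp
    qed
    have "{- int N..int N} \<subseteq> int ` {..N} \<union> (\<lambda>n. - int n) ` {..N}"
    proof
      fix j assume "j \<in> {- int N..int N}"
      then have "j = int (nat j) \<and> nat j \<le> N \<or> j = - int (nat (- j)) \<and> nat (- j) \<le> N" by auto
      then show "j \<in> int ` {..N} \<union> (\<lambda>n. - int n) ` {..N}" by blast
    qed
    then have "(\<Sum>j\<in>{- int N..int N}. ?w j) \<le> (\<Sum>j\<in>int ` {..N} \<union> (\<lambda>n. - int n) ` {..N}. ?w j)"
      by (intro sum_mono2) auto
    also have "\<dots> \<le> (\<Sum>j\<in>int ` {..N}. ?w j) + (\<Sum>j\<in>(\<lambda>n. - int n) ` {..N}. ?w j)"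
      by (subst sum_Un) (auto intro!: sum_nonneg)
    also have "(\<Sum>j\<in>int ` {..N}. ?w j) = (\<Sum>n\<le>N. real (Suc n) powr - \<beta>)"
      by (rule im) simp
    also have "(\<Sum>j\<in>(\<lambda>n. - int n) ` {..N}. ?w j) = (\<Sum>n\<le>N. real (Suc n) powr - \<beta>)"
      by (rule im) simp
    also have "(\<Sum>n\<le>N. real (Suc n) powr - \<beta>) + (\<Sum>n\<le>N. real (Suc n) powr - \<beta>)
        \<le> 2 * (\<Sum>n. real (Suc n) powr - \<beta>)"
      using s[of N] by linarith
    finally show ?thesis .
  qed
  moreover have "0 \<le> (\<Sum>n. real (Suc n) powr - \<beta>)"
    by (intro suminf_nonneg \<open>summable (\<lambda>n. real (Suc n) powr - \<beta>)\<close>) auto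
  ultimately show ?thesis by (intro exI[of _ "2 * (\<Sum>n. real (Suc n) powr - \<beta>)"]) auto
qed

lemma freq_sq_nonneg: "0 \<le> freq_sq k"
  by (simp add: freq_sq_def sum_nonneg)

lemma freq_sq_lower_bound:
  assumes "k \<noteq> (\<lambda>_. 0)"
  shows "(1 + real_of_int \<bar>k i\<bar>)\<^sup>2 \<le> freq_sq k"
proof -
  have *: "(2 * pi * of_int (k j))\<^sup>2 \<le> freq_sq k" for j
    unfolding freq_sq_def by (rule member_le_sum) auto
  obtain j where j: "k j \<noteq> 0" using assms by auto
  obtain j' where j': "k j' \<noteq> 0" "\<bar>k i\<bar> \<le> \<bar>k j'\<bar>"
    using j by (cases "k i = 0") auto
  have "1 + real_of_int \<bar>k i\<bar> \<le> 2 * real_of_int \<bar>k j'\<bar>"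
    using j' by linarith
  also have "\<dots> \<le> 2 * pi * real_of_int \<bar>k j'\<bar>"
    using pi_gt3 by (intro mult_right_mono) auto
  finally have "(1 + real_of_int \<bar>k i\<bar>)\<^sup>2 \<le> (2 * pi * real_of_int \<bar>k j'\<bar>)\<^sup>2"
    by (intro power_mono) auto
  then show ?thesis using *[of j'] by (simp add: power_mult_distrib)
qed

text \<open>The lattice sum is dominated by a product of one-dimensional sums: for
  \<open>k\<close> different from 0 each factor \<open>1 + |k i|\<close> is at most the square root of \<open>freq_sq k\<close>, so the power \<open>1 - \<alpha>\<close> of
  \<open>freq_sq k\<close> can be distributed evenly over the \<open>d\<close> coordinates. The resulting exponent
  \<open>\<beta> = 2 (\<alpha> - 1) / d\<close> exceeds 1 precisely under the assumption on \<open>\<alpha>\<close>.\<close>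

lemma sum_spectrum_bounded:
  fixes \<mu> :: "('d::finite \<Rightarrow> int) \<Rightarrow> real"
  assumes \<alpha>: "1 + real CARD('d) / 2 < \<alpha>" and c: "0 \<le> c"
    and \<mu>: "\<And>k. k \<noteq> (\<lambda>_. 0) \<Longrightarrow> \<mu> k \<le> c * freq_sq k powr - \<alpha>"
  shows "\<exists>K\<ge>0. \<forall>N. (\<Sum>k\<in>frequency_box N. \<mu> k * freq_sq k) \<le> K"
proof -
  define \<beta> where "\<beta> = 2 * (\<alpha> - 1) / CARD('d)"
  have "1 < \<beta>"
    using \<alpha> by (simp add: \<beta>_def field_simps)
  from sum_int_interval_bounded[OF this]
  obtain W where W: "0 \<le> W" "\<And>N. (\<Sum>j\<in>{- int N..int N}. (1 + real_of_int \<bar>j\<bar>) powr - \<beta>) \<le> W"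
    by blast
  have bound: "\<mu> k * freq_sq k \<le> c * (\<Prod>i\<in>UNIV. (1 + real_of_int \<bar>k i\<bar>) powr - \<beta>)" for k
  proof (cases "k = (\<lambda>_. 0)")
    case True
    then show ?thesis using c by (simp add: freq_sq_def)
  next
    case False
    let ?f = "freq_sq k"
    have f: "0 < ?f"
      using freq_sq_lower_bound[OF False, of undefined] zero_less_power[of "1 + real_of_int \<bar>k undefined\<bar>" 2]
      by linarith
    have "?f powr (- \<beta> / 2) \<le> (1 + real_of_int \<bar>k i\<bar>) powr - \<beta>" for i
    proof -
      have "?f powr (- \<beta> / 2) \<le> ((1 + real_of_int \<bar>k i\<bar>)\<^sup>2) powr (- \<beta> / 2)"
        using freq_sq_lower_bound[OF False, of i] \<open>1 < \<beta>\<close> by (intro powr_mono2') auto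
      also have "\<dots> = (1 + real_of_int \<bar>k i\<bar>) powr - \<beta>"
        by (simp add: powr_powr flip: powr_numeral)
      finally show ?thesis .
    qed
    then have "(\<Prod>i\<in>(UNIV :: 'd set). ?f powr (- \<beta> / 2)) \<le> (\<Prod>i\<in>UNIV. (1 + real_of_int \<bar>k i\<bar>) powr - \<beta>)"
      by (intro prod_mono) auto
    also have "(\<Prod>i\<in>(UNIV :: 'd set). ?f powr (- \<beta> / 2)) = ?f powr (1 - \<alpha>)"
    proof -
      have "- \<beta> / 2 * real CARD('d) = 1 - \<alpha>" by (simp add: \<beta>_def field_simps)
      then have "(?f powr (- \<beta> / 2)) powr real CARD('d) = ?f powr (1 - \<alpha>)"
        by (simp only: powr_powr)
      then show ?thesis using f by (simp add: powr_realpow)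
    qed
    finally have "c * ?f powr (1 - \<alpha>) \<le> c * (\<Prod>i\<in>UNIV. (1 + real_of_int \<bar>k i\<bar>) powr - \<beta>)"
      using c by (intro mult_left_mono)
    moreover have "\<mu> k * ?f \<le> c * ?f powr - \<alpha> * ?f"
      using \<mu>[OF False] f by (intro mult_right_mono) auto
    moreover have "?f powr - \<alpha> * ?f = ?f powr (1 - \<alpha>)"
      using f powr_add[of ?f "- \<alpha>" 1] by simp
    ultimately show ?thesis by (simp add: mult.assoc)
  qed
  have "(\<Sum>k\<in>frequency_box N. \<mu> k * freq_sq k) \<le> c * W ^ CARD('d)" for N
  proof -
    have "(\<Sum>k\<in>frequency_box N. \<mu> k * freq_sq k) \<le>
      (\<Sum>k\<in>(frequency_box N :: ('d \<Rightarrow> int) set). c * (\<Prod>i\<in>UNIV. (1 + real_of_int \<bar>k i\<bar>) powr - \<beta>))"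
      by (intro sum_mono bound)
    also have "\<dots> = c * (\<Sum>j\<in>{- int N..int N}. (1 + real_of_int \<bar>j\<bar>) powr - \<beta>) ^ CARD('d)"
      unfolding sum_distrib_left[symmetric] sum_frequency_box_prod[of "\<lambda>j. (1 + real_of_int \<bar>j\<bar>) powr - \<beta>"] ..
    also have "\<dots> \<le> c * W ^ CARD('d)"
      using c W by (intro mult_left_mono power_mono sum_nonneg) auto
    finally show ?thesis .
  qed
  then show ?thesis using c W(1) by (intro exI[of _ "c * W ^ CARD('d)"]) auto
qed

section \<open>Total variation of the thresholded field\<close>

definition gradient_sq :: "nat \<Rightarrow> 'd::finite l2 \<Rightarrow> real ^ 'd \<Rightarrow> real" where
  "gradient_sq N v x = (\<Sum>i\<in>UNIV. (fourier_sum_partial N i v x)\<^sup>2)"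

text \<open>An upper bound for the total variation of \<open>arctan (m v\<^sub>N)\<close>. The factor \<open>1 + |\<nabla>v\<^sub>N|\<^sup>2\<close>
  dominates \<open>|\<nabla>v\<^sub>N|\<close>, and its expectation is given by the variances of the derivatives.\<close>

definition ramp_energy :: "real \<Rightarrow> nat \<Rightarrow> 'd::finite l2 \<Rightarrow> ennreal" where
  "ramp_energy m N v =
     (\<integral>\<^sup>+x. ennreal (ramp_slope m (fourier_sum N v x) * (1 + gradient_sq N v x)) \<partial>cube_measure)"

definition test_field :: "(real ^ 'd::finite \<Rightarrow> real ^ 'd) \<Rightarrow> bool" where
  "test_field \<phi> \<longleftrightarrow> C1 \<phi> \<and> compact (closure {x. \<phi> x \<noteq> 0}) \<and>
     closure {x. \<phi> x \<noteq> 0} \<subseteq> unit_cube \<and> (\<forall>x. norm (\<phi> x) \<le> 1)"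

lemma test_field_outside: "test_field \<phi> \<Longrightarrow> x \<notin> unit_cube \<Longrightarrow> \<phi> x = 0"
  unfolding test_field_def using closure_subset[of "{x. \<phi> x \<noteq> 0}"] by blast

lemma continuous_divergence: "test_field \<phi> \<Longrightarrow> continuous_on UNIV (divergence \<phi>)"
  unfolding divergence_def[abs_def] test_field_def
  by (intro continuous_intros continuous_on_component C1_continuous_partial) auto

text \<open>Integration by parts moves the divergence onto the ramp, whose gradient is the slope times
  \<open>\<nabla>v\<^sub>N\<close>; a test field has length at most 1.\<close>

lemma integral_ramp_divergence_le:
  fixes \<phi> :: "real ^ 'd::finite \<Rightarrow> real ^ 'd"
  assumes \<phi>: "test_field \<phi>" and m: "0 < m"
  shows "ennreal (\<integral>x. arctan (m * fourier_sum N v x) * divergence \<phi> x \<partial>cube_measure) \<le> ramp_energy m N v"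
proof -
  let ?u = "fourier_sum N v" and ?D = "\<lambda>i. fourier_sum_partial N i v"
  let ?g = "\<lambda>x. ramp_slope m (?u x)"
  let ?E = "\<lambda>x. ?g x * (1 + gradient_sq N v x)"
  have C1: "C1 \<phi>" using \<phi> by (simp add: test_field_def)
  have cont: "continuous_on UNIV ?g" "continuous_on UNIV (\<lambda>x. arctan (m * ?u x))"
    "continuous_on UNIV (\<lambda>x. \<phi> x $ i)" "continuous_on UNIV (\<lambda>x. partial_deriv i \<phi> x $ i)"
    "continuous_on UNIV (?D i)" for i
    by (auto intro!: continuous_on_compose2[OF continuous_ramp_slope] continuous_intros continuous_fourier_sum
        continuous_fourier_sum_partial continuous_on_component C1_continuous[OF C1] C1_continuous_partial[OF C1])
  have cont_E: "continuous_on UNIV ?E"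
    unfolding gradient_sq_def by (intro continuous_intros cont)
  have zero: "(\<integral>x. ?g x * ?D i x * \<phi> x $ i + arctan (m * ?u x) * partial_deriv i \<phi> x $ i \<partial>cube_measure) = 0" for i
  proof (rule integral_cube_partial_eq_0)
    show "continuous_on UNIV (\<lambda>x. ?g x * ?D i x * \<phi> x $ i + arctan (m * ?u x) * partial_deriv i \<phi> x $ i)"
      by (intro continuous_intros cont)
    show "((\<lambda>t. arctan (m * ?u (x + t *\<^sub>R axis i 1)) * \<phi> (x + t *\<^sub>R axis i 1) $ i) has_real_derivative
        ?g x * ?D i x * \<phi> x $ i + arctan (m * ?u x) * partial_deriv i \<phi> x $ i) (at 0)" for x
    proof -
      have a: "((\<lambda>t. arctan (m * ?u (x + t *\<^sub>R axis i 1))) has_real_derivative ?g x * ?D i x) (at 0)"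
        using DERIV_chain2[OF DERIV_ramp fourier_sum_line_derivative[of N v x i], of m] by simp
      have b: "((\<lambda>t. \<phi> (x + t *\<^sub>R axis i 1) $ i) has_real_derivative partial_deriv i \<phi> x $ i) (at 0)"
        using bounded_linear.has_vector_derivative[OF bounded_linear_vec_nth C1_line_derivative[OF C1]]
        by (simp add: has_real_derivative_iff_has_vector_derivative)
      show ?thesis
        using DERIV_mult[OF a b] by (simp add: mult.commute)
    qed
    show "arctan (m * ?u (x + axis i 1)) * \<phi> (x + axis i 1) $ i = arctan (m * ?u x) * \<phi> x $ i"
      if "x $ i = 0" for x
    proof -
      have "x \<notin> unit_cube" "x + axis i 1 \<notin> unit_cube"
        using that by (auto simp: unit_cube_def axis_def intro!: exI[of _ i])
      then show ?thesis by (simp add: test_field_outside[OF \<phi>])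
    qed
  qed
  have int: "integrable cube_measure (\<lambda>x. ?g x * ?D i x * \<phi> x $ i)"
    "integrable cube_measure (\<lambda>x. arctan (m * ?u x) * partial_deriv i \<phi> x $ i)" for i
    by (intro continuous_integrable_cube continuous_intros cont)+
  have "(\<integral>x. arctan (m * ?u x) * divergence \<phi> x \<partial>cube_measure) =
    (\<Sum>i\<in>UNIV. \<integral>x. arctan (m * ?u x) * partial_deriv i \<phi> x $ i \<partial>cube_measure)"
    unfolding divergence_def sum_distrib_left by (rule Bochner_Integration.integral_sum) (rule int)
  also have "\<dots> = (\<Sum>i\<in>UNIV. - (\<integral>x. ?g x * ?D i x * \<phi> x $ i \<partial>cube_measure))"
  proof (rule sum.cong)
    show "(\<integral>x. arctan (m * ?u x) * partial_deriv i \<phi> x $ i \<partial>cube_measure) =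
        - (\<integral>x. ?g x * ?D i x * \<phi> x $ i \<partial>cube_measure)" for i
      using zero[of i] unfolding Bochner_Integration.integral_add[OF int] by linarith
  qed simp
  also have "\<dots> = (\<integral>x. (\<Sum>i\<in>UNIV. - (?g x * ?D i x * \<phi> x $ i)) \<partial>cube_measure)"
    using int by (subst Bochner_Integration.integral_sum) auto
  also have "\<dots> \<le> (\<integral>x. ?E x \<partial>cube_measure)"
  proof (rule integral_mono)
    show "integrable cube_measure (\<lambda>x. \<Sum>i\<in>UNIV. - (?g x * ?D i x * \<phi> x $ i))"
      by (intro Bochner_Integration.integrable_sum integrable_minus int)
    show "integrable cube_measure ?E" by (intro continuous_integrable_cube cont_E)
    fix x
    have young: "- (a * b) \<le> a\<^sup>2 + b\<^sup>2" for a b :: real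
      using zero_le_power2[of "a + b"] zero_le_power2[of a] zero_le_power2[of b] 
      unfolding power2_sum by linarith
    have "(\<Sum>i\<in>UNIV. - (?D i x * \<phi> x $ i)) \<le> (\<Sum>i\<in>UNIV. (?D i x)\<^sup>2 + (\<phi> x $ i)\<^sup>2)"
      by (intro sum_mono young)
    also have "\<dots> = gradient_sq N v x + (norm (\<phi> x))\<^sup>2"
      by (simp add: sum.distrib gradient_sq_def norm_vec_def L2_set_def sum_nonneg)
    also have "(norm (\<phi> x))\<^sup>2 \<le> 1"
      using \<phi> by (simp add: test_field_def power_le_one)
    finally have "?g x * (\<Sum>i\<in>UNIV. - (?D i x * \<phi> x $ i)) \<le> ?g x * (1 + gradient_sq N v x)"
      using ramp_slope_bounds(1)[OF m] by (intro mult_left_mono) auto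
    then show "(\<Sum>i\<in>UNIV. - (?g x * ?D i x * \<phi> x $ i)) \<le> ?E x"
      by (simp add: sum_distrib_left mult.assoc sum_negf)
  qed
  finally have "ennreal (\<integral>x. arctan (m * ?u x) * divergence \<phi> x \<partial>cube_measure) \<le> ennreal (\<integral>x. ?E x \<partial>cube_measure)"
    by (rule ennreal_leI)
  also have "\<dots> = ramp_energy m N v"
    unfolding ramp_energy_def
  proof (rule nn_integral_eq_integral[symmetric])
    show "integrable cube_measure ?E" by (intro continuous_integrable_cube cont_E)
    show "AE x in cube_measure. 0 \<le> ?E x"
      using ramp_slope_bounds(1)[OF m] by (intro AE_I2 mult_nonneg_nonneg) (auto simp: gradient_sq_def sum_nonneg)
  qed
  finally show ?thesis .
qed

text \<open>For fixed \<open>m\<close> the ramp is Lipschitz continuous, so convergence in \<open>L\<^sup>2\<close> passes through it.\<close>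

lemma integral_ramp_tendsto:
  assumes w: "represents w v" and m: "0 < m" and D: "continuous_on UNIV D"
  shows "(\<lambda>N. \<integral>x. arctan (m * fourier_sum N v x) * D x \<partial>cube_measure) \<longlonglongrightarrow>
    (\<integral>x. arctan (m * w x) * D x \<partial>cube_measure)"
proof -
  have w': "square_integrable w" "l2_class w = v" using w by (auto simp: represents_def)
  have [measurable]: "w \<in> borel_measurable cube_measure" using w' by (simp add: square_integrable_def)
  have sD: "square_integrable D" by (rule square_integrable_continuous) (rule D)
  have sN: "square_integrable (fourier_sum N v)" for N
    by (rule square_integrable_continuous) (rule continuous_fourier_sum)
  have satan: "square_integrable (\<lambda>x. arctan (m * f x))" if "square_integrable f" for f :: "real ^ 'a \<Rightarrow> real"
  proof (rule square_integrable_bounded)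
    show "(\<lambda>x. arctan (m * f x)) \<in> borel_measurable cube_measure"
      using that by (auto simp: square_integrable_def)
    show "\<bar>arctan (m * f x)\<bar> \<le> pi / 2" for x
      using arctan_bounded[of "m * f x"] by linarith
  qed
  let ?A = "\<lambda>f. l2_class (\<lambda>x. arctan (m * f x))"
  have "(\<lambda>N. ?A (fourier_sum N v)) \<longlonglongrightarrow> ?A w"
  proof (rule tendstoI)
    fix e :: real assume "0 < e"
    then have "eventually (\<lambda>N. dist (l2_class (fourier_sum N v)) v < e / m) sequentially"
      using m by (intro tendstoD[OF fourier_sum_tendsto]) simp
    then show "eventually (\<lambda>N. dist (?A (fourier_sum N v)) (?A w) < e) sequentially"
    proof eventually_elim
      case (elim N)
      have "dist (?A (fourier_sum N v)) (?A w) = norm (l2_class (\<lambda>x. arctan (m * fourier_sum N v x) - arctan (m * w x)))"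
        unfolding dist_norm by (simp only: l2_class_diff[OF satan[OF sN] satan[OF w'(1)]])
      also have "\<dots> \<le> m * norm (l2_class (\<lambda>x. fourier_sum N v x - w x))"
        using m arctan_mult_lipschitz[OF m]
        by (intro norm_l2_class_mono square_integrable_diff satan sN w') auto
      also have "\<dots> = m * dist (l2_class (fourier_sum N v)) v"
        unfolding dist_norm by (simp only: l2_class_diff[OF sN w'(1)] w'(2))
      also have "\<dots> < e" using elim m by (simp add: field_simps)
      finally show ?case .
    qed
  qed
  then have "(\<lambda>N. inner (?A (fourier_sum N v)) (l2_class D)) \<longlonglongrightarrow> inner (?A w) (l2_class D)"
    by (intro tendsto_intros)
  then show ?thesis
    by (simp add: inner_l2_class[OF satan[OF sN] sD] inner_l2_class[OF satan[OF w'(1)] sD])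
qed

text \<open>The limits are taken in the order of the hypothesis: \<open>N \<rightarrow> \<infinity>\<close> for a fixed slope, and then
  the slope tends to infinity by dominated convergence. Since \<open>arctan 0 = 0 = sgn 0\<close>, the limit is
  correct also on the zero set of \<open>w\<close>, whatever its measure.\<close>

lemma total_variation_sgn_le:
  fixes v :: "'d::finite l2"
  assumes fin: "liminf (\<lambda>n. liminf (\<lambda>N. ramp_energy (real (Suc n)) N v)) < \<infinity>" (is "?I < _")
    and w: "represents w v"
  shows "total_variation (\<lambda>x. sgn (w x)) < \<infinity>"
proof -
  have [measurable]: "w \<in> borel_measurable cube_measure"
    using w by (simp add: represents_def square_integrable_def)
  have "(\<integral>x. sgn (w x) * divergence \<phi> x \<partial>cube_measure) \<le> 2 / pi * enn2real ?I"
    if \<phi>: "test_field \<phi>" for \<phi> :: "real ^ 'd \<Rightarrow> real ^ 'd"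
  proof -
    let ?D = "divergence \<phi>"
    note D = continuous_divergence[OF \<phi>]
    have [measurable]: "?D \<in> borel_measurable cube_measure"
      by (rule continuous_measurable_cube) (rule D)
    let ?J = "\<lambda>n. \<integral>x. arctan (real (Suc n) * w x) * ?D x \<partial>cube_measure"
    have "ennreal (?J n) \<le> liminf (\<lambda>N. ramp_energy (real (Suc n)) N v)" for n
    proof -
      let ?m = "real (Suc n)"
      have "(\<lambda>N. ennreal (\<integral>x. arctan (?m * fourier_sum N v x) * ?D x \<partial>cube_measure)) \<longlonglongrightarrow> ennreal (?J n)"
        by (intro tendsto_ennrealI integral_ramp_tendsto[OF w _ D]) simp
      then have "ennreal (?J n) = liminf (\<lambda>N. ennreal (\<integral>x. arctan (?m * fourier_sum N v x) * ?D x \<partial>cube_measure))"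
        by (intro lim_imp_Liminf[symmetric]) auto
      also have "\<dots> \<le> liminf (\<lambda>N. ramp_energy ?m N v)"
        by (intro Liminf_mono always_eventually allI integral_ramp_divergence_le[OF \<phi>]) simp
      finally show ?thesis .
    qed
    then have "liminf (\<lambda>n. ennreal (?J n)) \<le> ?I"
      by (intro Liminf_mono always_eventually allI)
    moreover have "?J \<longlonglongrightarrow> (\<integral>x. pi / 2 * sgn (w x) * ?D x \<partial>cube_measure)"
    proof (rule integral_dominated_convergence)
      show "integrable cube_measure (\<lambda>x. pi / 2 * \<bar>?D x\<bar>)"
        by (intro continuous_integrable_cube continuous_intros D)
      show "AE x in cube_measure. (\<lambda>n. arctan (real (Suc n) * w x) * ?D x) \<longlonglongrightarrow> pi / 2 * sgn (w x) * ?D x"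
        by (intro AE_I2 tendsto_mult arctan_mult_tendsto_sgn tendsto_const)
      have "\<bar>arctan y\<bar> \<le> pi / 2" for y
        using arctan_bounded[of y] by linarith
      then show "AE x in cube_measure. norm (arctan (real (Suc n) * w x) * ?D x) \<le> pi / 2 * \<bar>?D x\<bar>" for n
        unfolding real_norm_def abs_mult by (intro AE_I2 mult_right_mono) auto
    qed measurable
    then have "(\<lambda>n. ennreal (?J n)) \<longlonglongrightarrow> ennreal (\<integral>x. pi / 2 * sgn (w x) * ?D x \<partial>cube_measure)"
      by (rule tendsto_ennrealI)
    then have "liminf (\<lambda>n. ennreal (?J n)) = ennreal (\<integral>x. pi / 2 * sgn (w x) * ?D x \<partial>cube_measure)"
      by (intro lim_imp_Liminf) auto
    ultimately have "ennreal (\<integral>x. pi / 2 * sgn (w x) * ?D x \<partial>cube_measure) \<le> ennreal (enn2real ?I)"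
      using fin by (simp add: less_top)
    then have "(\<integral>x. pi / 2 * sgn (w x) * ?D x \<partial>cube_measure) \<le> enn2real ?I"
      by (simp add: ennreal_le_iff)
    then show ?thesis
      by (simp add: mult.assoc field_simps)
  qed
  then have "total_variation (\<lambda>x. sgn (w x)) \<le> ereal (2 / pi * enn2real ?I)"
    unfolding total_variation_def by (intro SUP_least) (simp add: test_field_def)
  then show ?thesis by (rule le_less_trans) simp
qed

text \<open>By Tonelli's theorem it suffices to bound the expectation of the integrand at each point
  \<open>x\<close>. There the slope contributes at most \<open>\<pi>\<close> divided by the standard deviation of \<open>v\<^sub>N(x)\<close>,
  which the zero mode bounds from below uniformly in \<open>N\<close>, and each squared derivative contributes
  its variance as an independent factor.\<close>

lemma expected_ramp_energy_le:
  fixes v :: "'w \<Rightarrow> 'd::finite l2" and \<mu> :: "('d \<Rightarrow> int) \<Rightarrow> real"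
  assumes "prob_space M" and v [measurable]: "v \<in> borel_measurable M"
    and law: "gaussian_measure (distr M borel v) 0 Q"
    and Q: "\<And>f k \<theta>. inner (Q f) (mode k \<theta>) = \<mu> k * inner f (mode k \<theta>)"
    and \<mu>: "\<And>k. 0 < \<mu> k"
    and K: "0 \<le> K" "(\<Sum>k\<in>frequency_box N. \<mu> k * freq_sq k) \<le> K" and m: "0 < m"
  shows "(\<lambda>\<omega>. ramp_energy m N (v \<omega>)) \<in> borel_measurable M"
    and "(\<integral>\<^sup>+\<omega>. ramp_energy m N (v \<omega>) \<partial>M) \<le> ennreal (pi / sqrt (\<mu> (\<lambda>_. 0)) * (1 + K))"
proof -
  interpret M: prob_space M by fact
  interpret pair_sigma_finite M "cube_measure :: (real ^ 'd) measure"
    by (intro pair_sigma_finite.intro M.sigma_finite_measure cube.sigma_finite_measure)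
  let ?U = "\<lambda>\<omega> x. fourier_sum N (v \<omega>) x" and ?Y = "\<lambda>i \<omega> x. fourier_sum_partial N i (v \<omega>) x"
  let ?g = "ramp_slope m"
  let ?E = "\<lambda>\<omega> x. ennreal (?g (?U \<omega> x) * (1 + gradient_sq N (v \<omega>) x))"
  have inner_v [measurable]: "(\<lambda>\<omega>. inner (v \<omega>) h) \<in> borel_measurable M" for h
    using v by (rule measurable_compose) (intro borel_measurable_continuous_onI continuous_intros)
  have [measurable]: "wave k \<theta> \<in> borel_measurable cube_measure" for k :: "'d \<Rightarrow> int" and \<theta>
    by (rule continuous_measurable_cube) (rule continuous_wave)
  have joint [measurable]: "(\<lambda>(\<omega>, x). ?E \<omega> x) \<in> borel_measurable (M \<Otimes>\<^sub>M cube_measure)"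
    unfolding gradient_sq_def fourier_sum_eq fourier_sum_partial_eq by measurable
  show "(\<lambda>\<omega>. ramp_energy m N (v \<omega>)) \<in> borel_measurable M"
    unfolding ramp_energy_def
    by (rule sigma_finite_measure.borel_measurable_nn_integral[OF cube.sigma_finite_measure joint])
  let ?s = "\<Sum>k\<in>frequency_box N. \<mu> k"
  have s: "\<mu> (\<lambda>_. 0) \<le> ?s"
    using \<mu> by (intro member_le_sum zero_in_frequency_box) (auto intro: less_imp_le)
  then have s0: "0 < ?s" using \<mu>[of "\<lambda>_. 0"] by linarith
  have point: "(\<integral>\<^sup>+\<omega>. ?E \<omega> x \<partial>M) \<le> ennreal (pi / sqrt (\<mu> (\<lambda>_. 0)) * (1 + K))" for x
  proof -
    have [measurable]: "(\<lambda>\<omega>. ?U \<omega> x) \<in> borel_measurable M" "(\<lambda>\<omega>. ?Y i \<omega> x) \<in> borel_measurable M" for i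
      unfolding fourier_sum_def fourier_sum_partial_def by measurable
    let ?b = "\<lambda>i. \<Sum>k\<in>frequency_box N. \<mu> k * (2 * pi * of_int (k i))\<^sup>2"
    have b0: "0 \<le> ?b i" for i
      using \<mu> by (intro sum_nonneg mult_nonneg_nonneg) (auto intro: less_imp_le)
    have marg: "distr M borel (\<lambda>\<omega>. inner (v \<omega>) h) = normal_law 0 (sqrt (inner (Q h) h))"
      "0 \<le> inner (Q h) h" for h
    proof -
      have "distr (distr M borel v) borel (\<lambda>f. inner f h) = distr M borel (\<lambda>\<omega>. inner (v \<omega>) h)"
        by (subst distr_distr) (auto simp: comp_def intro!: borel_measurable_continuous_onI continuous_intros)
      then show "distr M borel (\<lambda>\<omega>. inner (v \<omega>) h) = normal_law 0 (sqrt (inner (Q h) h))"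
        using gaussian_measure_marginal(2)[OF law, of h] by simp
      show "0 \<le> inner (Q h) h" by (rule gaussian_measure_marginal(1)[OF law])
    qed
    have char: "(CLINT \<omega>|M. iexp (s * ?U \<omega> x + t * ?Y i \<omega> x)) = exp (- (s\<^sup>2 * ?s + t\<^sup>2 * ?b i) / 2)" for s t i
    proof -
      define h where "h = s *\<^sub>R kernel N x + t *\<^sub>R kernel_partial N i x"
      have "(CLINT \<omega>|M. iexp (s * ?U \<omega> x + t * ?Y i \<omega> x)) = (CLINT \<omega>|M. iexp (1 * inner (v \<omega>) h))"
        by (simp add: h_def inner_add_right fourier_sum_def fourier_sum_partial_def)
      also have "\<dots> = char (distr M borel (\<lambda>\<omega>. inner (v \<omega>) h)) 1"
        unfolding char_def by (rule integral_distr[symmetric]) auto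
      also have "\<dots> = exp (- inner (Q h) h / 2)"
        unfolding marg(1) using marg(2)[of h] by (subst char_normal_law) auto
      also have "inner (Q h) h = s\<^sup>2 * ?s + t\<^sup>2 * ?b i"
        unfolding h_def by (rule covariance_kernel) (rule Q)
      finally show ?thesis .
    qed
    define G where "G = M.expectation (\<lambda>\<omega>. ?g (?U \<omega> x))"
    have G0: "0 \<le> G" unfolding G_def using ramp_slope_bounds(1)[OF m] by simp
    have G: "G \<le> pi / sqrt (\<mu> (\<lambda>_. 0))"
    proof -
      have "inner (Q (kernel N x)) (kernel N x) = ?s"
        using covariance_kernel[where Q=Q and \<mu>=\<mu> and N=N and x=x and s=1 and t=0, OF Q] by simp
      then have "distr M borel (\<lambda>\<omega>. ?U \<omega> x) = normal_law 0 (sqrt ?s)"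
        unfolding fourier_sum_def using marg(1)[of "kernel N x"] by simp
      moreover have "G = (\<integral>u. ?g u \<partial>distr M borel (\<lambda>\<omega>. ?U \<omega> x))"
        unfolding G_def by (rule integral_distr[symmetric]) auto
      ultimately have "G \<le> pi / sqrt ?s"
        using integral_ramp_slope_normal_law[OF m, of "sqrt ?s"] s0 by simp
      also have "\<dots> \<le> pi / sqrt (\<mu> (\<lambda>_. 0))"
        using s \<mu>[of "\<lambda>_. 0"] by (intro divide_left_mono) auto
      finally show ?thesis .
    qed
    have "(\<integral>\<^sup>+\<omega>. ?E \<omega> x \<partial>M) = (\<integral>\<^sup>+\<omega>. ennreal (?g (?U \<omega> x)) + (\<Sum>i\<in>UNIV. ennreal (?g (?U \<omega> x) * (?Y i \<omega> x)\<^sup>2)) \<partial>M)"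
    proof (rule nn_integral_cong)
      fix \<omega>
      have "?E \<omega> x = ennreal (?g (?U \<omega> x) + (\<Sum>i\<in>UNIV. ?g (?U \<omega> x) * (?Y i \<omega> x)\<^sup>2))"
        by (simp add: gradient_sq_def distrib_left sum_distrib_left)
      also have "\<dots> = ennreal (?g (?U \<omega> x)) + ennreal (\<Sum>i\<in>UNIV. ?g (?U \<omega> x) * (?Y i \<omega> x)\<^sup>2)"
        using ramp_slope_bounds(1)[OF m] by (intro ennreal_plus sum_nonneg) auto
      also have "ennreal (\<Sum>i\<in>UNIV. ?g (?U \<omega> x) * (?Y i \<omega> x)\<^sup>2) = (\<Sum>i\<in>UNIV. ennreal (?g (?U \<omega> x) * (?Y i \<omega> x)\<^sup>2))"
        using ramp_slope_bounds(1)[OF m] by (intro sum_ennreal[symmetric]) auto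
      finally show "?E \<omega> x = ennreal (?g (?U \<omega> x)) + (\<Sum>i\<in>UNIV. ennreal (?g (?U \<omega> x) * (?Y i \<omega> x)\<^sup>2))" .
    qed
    also have "\<dots> = (\<integral>\<^sup>+\<omega>. ennreal (?g (?U \<omega> x)) \<partial>M) + (\<Sum>i\<in>UNIV. \<integral>\<^sup>+\<omega>. ennreal (?g (?U \<omega> x) * (?Y i \<omega> x)\<^sup>2) \<partial>M)"
      by (subst nn_integral_add) (auto intro!: nn_integral_sum)
    also have "(\<integral>\<^sup>+\<omega>. ennreal (?g (?U \<omega> x)) \<partial>M) = ennreal G"
      unfolding G_def
    proof (rule nn_integral_eq_integral)
      show "integrable M (\<lambda>\<omega>. ?g (?U \<omega> x))"
        using ramp_slope_bounds[OF m] by (intro M.integrable_const_bound[where B=m] AE_I2) auto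
    qed (use ramp_slope_bounds(1)[OF m] in auto)
    also have "ennreal G + (\<Sum>i\<in>UNIV. \<integral>\<^sup>+\<omega>. ennreal (?g (?U \<omega> x) * (?Y i \<omega> x)\<^sup>2) \<partial>M) \<le>
        ennreal G + (\<Sum>i\<in>UNIV. ennreal (?b i * G))"
      unfolding G_def
      by (intro add_left_mono sum_mono M.uncorrelated_gaussian_moment[OF _ _ _ char b0 ramp_slope_bounds[OF m]]) measurable
    also have "\<dots> = ennreal (G + (\<Sum>i\<in>UNIV. ?b i * G))"
      using G0 b0 by (simp add: sum_ennreal sum_nonneg)
    also have "G + (\<Sum>i\<in>UNIV. ?b i * G) = G * (1 + (\<Sum>k\<in>frequency_box N. \<mu> k * freq_sq k))"
      unfolding freq_sq_def sum_distrib_left sum_distrib_right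
      by (subst sum.swap) (simp add: distrib_left sum_distrib_left mult.commute)
    also have "ennreal \<dots> \<le> ennreal (pi / sqrt (\<mu> (\<lambda>_. 0)) * (1 + K))"
    proof (intro ennreal_leI mult_mono G add_left_mono K)
      have "0 \<le> (\<Sum>k\<in>frequency_box N. \<mu> k * freq_sq k)"
        using \<mu> by (intro sum_nonneg mult_nonneg_nonneg freq_sq_nonneg) (auto intro: less_imp_le)
      then show "0 \<le> 1 + (\<Sum>k\<in>frequency_box N. \<mu> k * freq_sq k)" by simp
    qed (use \<mu>[of "\<lambda>_. 0"] in auto)
    finally show ?thesis .
  qed
  have "(\<integral>\<^sup>+\<omega>. ramp_energy m N (v \<omega>) \<partial>M) = (\<integral>\<^sup>+x. (\<integral>\<^sup>+\<omega>. ?E \<omega> x \<partial>M) \<partial>cube_measure)"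
    unfolding ramp_energy_def using Fubini'[OF joint] by simp
  also have "\<dots> \<le> (\<integral>\<^sup>+x. ennreal (pi / sqrt (\<mu> (\<lambda>_. 0)) * (1 + K)) \<partial>(cube_measure :: (real ^ 'd) measure))"
    by (intro nn_integral_mono point)
  also have "\<dots> = ennreal (pi / sqrt (\<mu> (\<lambda>_. 0)) * (1 + K))"
    by (simp add: emeasure_cube_measure)
  finally show "(\<integral>\<^sup>+\<omega>. ramp_energy m N (v \<omega>) \<partial>M) \<le> ennreal (pi / sqrt (\<mu> (\<lambda>_. 0)) * (1 + K))" .
qed

lemma nn_integral_liminf_le:
  fixes f :: "nat \<Rightarrow> 'a \<Rightarrow> ennreal"
  assumes "\<And>n. f n \<in> borel_measurable M" "\<And>n. (\<integral>\<^sup>+x. f n x \<partial>M) \<le> c"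
  shows "(\<integral>\<^sup>+x. liminf (\<lambda>n. f n x) \<partial>M) \<le> c"
proof -
  have "(\<integral>\<^sup>+x. liminf (\<lambda>n. f n x) \<partial>M) \<le> liminf (\<lambda>n. \<integral>\<^sup>+x. f n x \<partial>M)"
    by (rule nn_integral_liminf) (rule assms)
  also have "\<dots> \<le> c"
    using assms(2) by (intro Liminf_le) (auto simp: always_eventually)
  finally show ?thesis .
qed

theorem lemma2p1:
  fixes \<delta> \<epsilon> q \<tau> a1 a2 a3 \<alpha> :: real
    and C Q :: "'d::finite l2 \<Rightarrow> 'd l2"
    and M :: "'w measure"
    and v :: "'w \<Rightarrow> 'd l2"
  assumes dim: "CARD('d) = 2 \<or> CARD('d) = 3"
    and "0 < \<epsilon>" "\<epsilon> < 1" "0 < \<delta>" "0 < \<tau>" "0 \<le> q" "0 \<le> a1" "0 \<le> a2" "0 \<le> a3"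
    and alpha: "\<alpha> > 1 + real CARD('d) / 2"
    and C: "solution_operator \<delta> \<epsilon> q \<tau> a1 a2 a3 C"
    and Q: "fractional_power C (\<alpha> / 2) Q"
    and M: "prob_space M"
    and v: "v \<in> borel_measurable M"
    and law: "gaussian_measure (distr M borel v) 0 Q"
  shows "AE \<omega> in M. \<forall>w. represents w (v \<omega>) \<longrightarrow> total_variation (\<lambda>x. sgn (w x)) < \<infinity>"
proof -
  let ?S = "symbol \<delta> \<epsilon> q \<tau> a1 a2 a3 :: ('d \<Rightarrow> int) \<Rightarrow> real"
  define \<mu> where "\<mu> k = ?S k powr - (\<alpha> / 2)" for k
  define A where "A = \<delta> * \<epsilon> powr (- 2 * a1)"
  have A: "0 < A" using assms(2-5) by (simp add: A_def)
  have S_ge: "A * (freq_sq k)\<^sup>2 \<le> ?S k" and S_pos: "0 < ?S k" for k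
  proof -
    have "0 \<le> q * \<delta> * \<epsilon> powr (- 2 * a2) * freq_sq k" "0 < \<tau>\<^sup>2 * \<delta> * \<epsilon> powr (- 2 * a3)"
      using assms(2-6) by (simp_all add: freq_sq_nonneg)
    moreover have "0 \<le> A * (freq_sq k)\<^sup>2" using A by simp
    ultimately show "A * (freq_sq k)\<^sup>2 \<le> ?S k" "0 < ?S k"
      unfolding symbol_def A_def by linarith+
  qed
  have \<mu>_pos: "0 < \<mu> k" for k
    using S_pos[of k] by (simp add: \<mu>_def)
  have \<mu>_le: "\<mu> k \<le> A powr - (\<alpha> / 2) * freq_sq k powr - \<alpha>" if "k \<noteq> (\<lambda>_. 0)" for k
  proof -
    have f: "0 < freq_sq k"
      using freq_sq_lower_bound[OF that, of undefined] zero_less_power[of "1 + real_of_int \<bar>k undefined\<bar>" 2]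
      by linarith
    have "\<mu> k \<le> (A * (freq_sq k)\<^sup>2) powr - (\<alpha> / 2)"
      unfolding \<mu>_def using S_ge[of k] A f alpha by (intro powr_mono2') auto
    also have "\<dots> = A powr - (\<alpha> / 2) * ((freq_sq k) powr 2) powr - (\<alpha> / 2)"
      using A f by (simp add: powr_mult)
    also have "\<dots> = A powr - (\<alpha> / 2) * freq_sq k powr - \<alpha>"
      by (simp add: powr_powr del: powr_numeral)
    finally show ?thesis .
  qed
  obtain K where K: "0 \<le> K" "\<And>N. (\<Sum>k\<in>frequency_box N. \<mu> k * freq_sq k) \<le> K"
    using sum_spectrum_bounded[OF alpha, of "A powr - (\<alpha> / 2)" \<mu>] \<mu>_le by auto
  have diag: "inner (Q f) (mode k \<theta>) = \<mu> k * inner f (mode k \<theta>)" for f k \<theta>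
    unfolding \<mu>_def by (rule inner_covariance_mode[OF C Q S_pos])
  note energy = expected_ramp_energy_le[OF M v law diag \<mu>_pos K]
  let ?L = "\<lambda>\<omega>. liminf (\<lambda>n. liminf (\<lambda>N. ramp_energy (real (Suc n)) N (v \<omega>)))"
  let ?c = "ennreal (pi / sqrt (\<mu> (\<lambda>_. 0)) * (1 + K))"
  have meas [measurable]: "(\<lambda>\<omega>. ramp_energy (real (Suc n)) N (v \<omega>)) \<in> borel_measurable M" for n N
    by (rule energy(1)) simp
  have meas' [measurable]: "(\<lambda>\<omega>. liminf (\<lambda>N. ramp_energy (real (Suc n)) N (v \<omega>))) \<in> borel_measurable M" for n
    by (rule borel_measurable_liminf) (rule meas)
  have "(\<integral>\<^sup>+\<omega>. ?L \<omega> \<partial>M) \<le> ?c"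
    by (intro nn_integral_liminf_le meas meas' energy(2)) simp
  then have "(\<integral>\<^sup>+\<omega>. ?L \<omega> \<partial>M) \<noteq> \<infinity>"
    by (metis ennreal_less_top infinity_ennreal_def leD)
  then have "AE \<omega> in M. ?L \<omega> \<noteq> \<infinity>"
    by (intro nn_integral_PInf_AE borel_measurable_liminf meas')
  then show ?thesis
  proof eventually_elim
    case (elim \<omega>)
    then show ?case
      using total_variation_sgn_le[of "v \<omega>"] by (simp add: less_top)
  qed
qed

end
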